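(* Let $U^\epsilon$ and $\Gamma^t$ denote the piecewise constant approximation and wave sequences generated by the modified Front Tracking (mFT) scheme described in the context from initial data $u^o\in BV_{loc}$, with interaction times $0<t_1\le t_2\le\dots$. For each $\epsilon>0$ and $i\in\mathbb N$, the wave sequence $\Gamma^{t_i+}$ has bounded variation, that is, $$\mathcal V\big(\Gamma^{t_i+}\big):=\sum_j|\zeta_j|<\infty .$$ Moreover, for each $i$, the corresponding piecewise constant approximation satisfies $$U^\epsilon\in W^{1,\infty}_*\big(0,t_{i+1};BV_{loc},M_{loc}\big)$$ and lies in the space $\mathcal Z$ (on the time interval $(0,t_{i+1})$), so that $$f(U^\epsilon)\in L^\infty_*(0,t_{i+1};BV_{loc})\quad\text{and}\quad q(U^\epsilon)\in W^{1,\infty}_*(0,t_{i+1};BV_{loc},M_{loc}).$$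
   Context: System. $q(u)_t+f(u)_x=0$, $(x,t)\in\mathbb R\times(0,T)$, $u\in\mathcal U\subset\mathbb R^N$, with $q,f:\mathcal U\to\mathbb R^N$ of class $C^2$ and data $u(\cdot,0)=u^o\in BV_{loc}$. It is strictly hyperbolic: $Df(u)r_i(u)=\lambda_i(u)Dq(u)r_i(u)$ with real $\lambda_1(u)<\dots<\lambda_N(u)$; each field is either genuinely nonlinear (GNL, $r_k\cdot\nabla\lambda_k>0$) or linearly degenerate (LD, $r_k\cdot\nabla\lambda_k=0$). $W_k(u_0,\zeta)$ is the value at parameter $\zeta$ of the solution of $dU/d\zeta=r_k(U)$, $U(0)=u_0$ (simple waves; in a GNL family $\zeta>0$ is a rarefaction, $\zeta<0$ a compression). A $k$-shock joins $u_-$ to $u_+$ with speed $\sigma_k$ if $f(u_+)-f(u_-)=\sigma_k(q(u_+)-q(u_-))$, $\lambda_k(u_-)>\sigma_k>\lambda_k(u_+)$ and $\lambda_{k-1}(u_-)<\sigma_k<\lambda_{k+1}(u_+)$; it is assumed that $\sigma_k(u_\ell,u_m)<\sigma_{k'}(u_m,u_r)$ for $k<k'$ (extended Lax condition). $E_k(u_-,\zeta)$ equals $W_k(u_-,\zeta)$ for $\zeta\ge0$ and parameterizes the admissible $k$-shock curve for $\zeta<0$ (for LD families $E_k=W_k$, contacts). $|\zeta|$ is the wave strength. Generalized Riemann problem (gRP): given $u_L,u_R$ and widths $w_k\ge0$ ($w_k=0$ for LD $k$), put $u_0=u_L$, $u_k=E_k(u_{k-1},\zeta_k)$ if $w_k=0$,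 $u_k=W_k(u_{k-1},\zeta_k)$ if $w_k>0$, and solve $u_N=u_R$. It is assumed that this always has a unique solution $(\zeta_k)$. States are in a fixed compact subset of $\mathcal U$, and waves in a compact spatial interval. Parameters. $\epsilon>0$; positive exponents with maximum rarefaction strength $\epsilon^{e_r}$, maximum and minimum absolute compression strengths $\epsilon^{e_c},\epsilon^{e_w}$, maximum passenger strength $\epsilon^{e_p}$, minimum initial discrete jump $\epsilon^{e_d}$, initial error $\epsilon^{e_i}$; $e_s=\min\{e_r,e_c\}$; $0<\kappa<1/3$ with $\epsilon^{e_p}<\kappa\epsilon^{e_r}$; $Q(\epsilon)\in(0,1)$. Wave sequence. $\Gamma^t=\{\gamma_j\}_{j=1}^{n}$ is a finite list of waves ordered in space. Each $\gamma_j$ has a family $k_j$, strength $\zeta_j$, left and right states $u_{j-1},u_j$ (exactly related by $W_{k_j}$ or $E_{k_j}$), speed $s_j$, position $x^p_j(t)$ moving with speed $s_j$, and virtual width $w_j(t)\ge0$ with $\dot w_j=\lambda_{k_j}(u_j)-\lambda_{k_j}(u_{j-1})$ for simple waves; the virtual edges move with speeds $\lambda_{k_j}(u_{j-1}),\lambda_{k_j}(u_j)$ and meet at the virtual center $(x^c_j,t^c_j)$. A compressive GNL wave is a shock iff its width is $0$. $\mathcal V(\Gamma)=\sum_j|\zeta_j|$ and $U^\epsilon(x,t)=u_0+\sum_j(u_j-u_{j-1})H(x-x_j^p(t))$ with $H$ the Heaviside function, $H(0)=1/2$. Each wave carries a preconditioner $A_j$ ($N\times N$, uniformly bounded with uniformly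 bounded inverse). Shocks and contacts have their exact speed; simple waves have the speed $s$ minimizing $|A_j([f]_j-s[q]_j)|$, where $[g]_j=g(u_j)-g(u_{j-1})$, except as modified below. Initialization. At each of the finitely many discontinuities of $u^o$ of size $\ge\epsilon^{e_d}$ the Riemann problem (all widths $0$) is solved, with rarefactions split into pieces of strength $<\epsilon^{e_r}$. Between consecutive such points finitely many points $x_j$ are chosen so that the total $BV$ and $L^1$ errors are $<\epsilon^{e_i}$; on each $(x_{j-1},x_j)$ the gRP with states $u^o(x_{j-1}+),u^o(x_j-)$ and GNL widths $w_k>0$, $\sum w_k<x_j-x_{j-1}$, is solved inside the interval, and each resulting wave is replaced by one jump with the corresponding center, least squares speed and virtual width at most $w_k$, without overlap. Interactions. Interaction times $0<t_1\le t_2\le\dots$ are the times at which adjacent waves meet or a compression collapses (its virtual width reaches $0$). At an interaction point $(x^!,t^!)$ the gRP is solved with the outer left and right states and outgoing widths $w_k'$, and every outgoing wave is a jump issuing from $(x^!,t^!)$. Widths: $w'_k=0$ for LD $k$; all $w'_k=0$ at a collapse; when two waves of the same family $k$ meet, $w'_k=0$ and the other widths are at most the larger incident width; when waves of different families meet, the outgoing widths in those families are at most those of the incident wave of the same family, and the other widths are at most the larger incident width. Further: (i) if an outgoing compression has strength outside $[-\epsilon^{e_c},-\epsilon^{e_w}]$ its width is reset to $0$ (making it a shock) and the gRP is re-solved, repeatedly, widths once reset remaining $0$; (ii) if an outermost outgoing simple wave would overlap the neighbouring simple wave of the same family, the virtual widths of both are reduced to avoid overlap, positions and speeds unchanged;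 (iii) an outgoing zero-width rarefaction stronger than $\epsilon^{e_r}$ is split, along the wave curve, into rarefactions of strengths in $[\kappa\epsilon^{e_r},\epsilon^{e_r}]$ with increasing speeds; (iv) an outgoing rarefaction of positive width stronger than $\epsilon^{e_r}$ is split into $2m+1$ rarefactions $i=-m,\dots,m$ of strengths in $[\kappa\epsilon^{e_r},\epsilon^{e_r}]$, symmetric in $i\mapsto-i$, all issuing from $(x^!,t^!)$ with temporary speeds $\tilde s^{(i)}$ given by $(\tilde s^{(i)}-s^{(i)})(t^\#-t^!)=(s^{(i)}-\lambda_k(\bar u))(t^!-t^c)$, where $s^{(i)}$ are the least squares speeds, $\bar u$ is the parameter midpoint of the whole rarefaction and $t^c$ the time of its virtual center; $t^\#$ is chosen with $(t^!-t^c)/(t^\#-t^!)=O(m\epsilon^{e_r})$, and at $t^\#$ the speeds revert to $s^{(i)}$ (multi-rarefaction). Composite waves. Outgoing waves of strength $\ge\epsilon^{e_p}$ are base waves (carriers). Every weaker outgoing wave is a passenger of a base wave issuing from the same point: the stronger of the base waves to its left and right, or the base wave on the only available side; all waves between a passenger and its carrier are passengers with the same carrier. If no base wave emerges, all outgoing waves are carried by the strongest of them (a lonely weak wave). A carrier and its passengers move as one discontinuity with a common speed and the carrier's width. A passenger $\gamma_j$ with carrier $\gamma_b$ is light if $|\zeta_j|\le Q(\epsilon)|\zeta_b|$, otherwise heavy. If all passengers are light the common speed is that of the carrier; otherwise it minimizes $|\sum_k A_k([f]_k-s[q]_k)|$, summed over all components. At its next interaction a composite wave enters through its outer left and right states.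 Function spaces. $BV_{loc}=(C_0^{-1})^*$ and $M_{loc}=(C_0^0)^*$ (Radon measures), where $C^{-1}_0$ denotes a predual of $BV$. $L^p_*(0,\tau;X^* )$ denotes Gelfand $p$-integrable functions, and $W^{1,p}_*(0,\tau;BV_{loc},M_{loc})$ the functions with values in $BV_{loc}$ whose Gelfand-weak time derivative exists in $L^p_*(0,\tau;M_{loc})$. On $(0,\tau)$, $\mathcal Z:=f^{-1}\big(L^\infty_*(0,\tau;BV_{loc})\big)\cap q^{-1}\big(W^{1,\infty}_*(0,\tau;BV_{loc},M_{loc})\big)$. *)

theory Defs
  imports "HOL-Analysis.Analysis"
begin

section \<open>The system of conservation laws\<close>

definition C1_on :: "'a::euclidean_space set \<Rightarrow> ('a \<Rightarrow> 'b::real_normed_vector) \<Rightarrow> bool" where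
  "C1_on D g \<longleftrightarrow> (\<exists>g' :: 'a \<Rightarrow> 'a \<Rightarrow>\<^sub>L 'b.
     (\<forall>u\<in>D. (g has_derivative blinfun_apply (g' u)) (at u)) \<and> continuous_on D g')"

definition C2_on :: "'a::euclidean_space set \<Rightarrow> ('a \<Rightarrow> 'b::real_normed_vector) \<Rightarrow> bool" where
  "C2_on D g \<longleftrightarrow> (\<exists>g' :: 'a \<Rightarrow> 'a \<Rightarrow>\<^sub>L 'b.
     (\<forall>u\<in>D. (g has_derivative blinfun_apply (g' u)) (at u)) \<and> C1_on D g')"

text \<open>
  \<open>shock_or_wave S k u \<zeta> u'\<close> is the graph of the (partially defined) function \<open>E\<^sub>k\<close>, that is,
  \<open>u' = E\<^sub>k(u, \<zeta>)\<close>. \<open>compact_states\<close> is the fixed compact set containing all states that occur.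
\<close>

record ('n::finite) claw =
  states :: "(real^'n) set"
  qfun :: "real^'n \<Rightarrow> real^'n"
  ffun :: "real^'n \<Rightarrow> real^'n"
  lam :: "nat \<Rightarrow> real^'n \<Rightarrow> real"
  rvec :: "nat \<Rightarrow> real^'n \<Rightarrow> real^'n"
  shock_or_wave :: "nat \<Rightarrow> real^'n \<Rightarrow> real \<Rightarrow> real^'n \<Rightarrow> bool"
  compact_states :: "(real^'n) set"

definition fams :: "('n::finite) claw \<Rightarrow> nat set" where
  "fams S = {1..CARD('n)}"

definition GNL :: "('n::finite) claw \<Rightarrow> nat \<Rightarrow> bool" where
  "GNL S k \<longleftrightarrow> (\<forall>u\<in>states S. frechet_derivative (lam S k) (at u) (rvec S k u) > 0)"

definition LD :: "('n::finite) claw \<Rightarrow> nat \<Rightarrow> bool" where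
  "LD S k \<longleftrightarrow> (\<forall>u\<in>states S. frechet_derivative (lam S k) (at u) (rvec S k u) = 0)"

text \<open>Graph of \<open>W\<^sub>k\<close>: \<open>u' = W\<^sub>k(u, \<zeta>)\<close>. The integral curve may run in either direction.\<close>

definition simple_wave :: "('n::finite) claw \<Rightarrow> nat \<Rightarrow> real^'n \<Rightarrow> real \<Rightarrow> real^'n \<Rightarrow> bool" where
  "simple_wave S k u \<zeta> u' \<longleftrightarrow> (\<exists>c. c 0 = u \<and> c \<zeta> = u' \<and>
     (\<forall>s\<in>closed_segment 0 \<zeta>. c s \<in> states S \<and>
        (c has_vector_derivative rvec S k (c s)) (at s within closed_segment 0 \<zeta>)))"

definition k_shock :: "('n::finite) claw \<Rightarrow> nat \<Rightarrow> real^'n \<Rightarrow> real^'n \<Rightarrow> real \<Rightarrow> bool" where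
  "k_shock S k um up \<sigma> \<longleftrightarrow> um \<in> states S \<and> up \<in> states S \<and>
     ffun S up - ffun S um = \<sigma> *\<^sub>R (qfun S up - qfun S um) \<and>
     lam S k um > \<sigma> \<and> \<sigma> > lam S k up \<and>
     (k - 1 \<in> fams S \<longrightarrow> lam S (k - 1) um < \<sigma>) \<and>
     (k + 1 \<in> fams S \<longrightarrow> \<sigma> < lam S (k + 1) up)"

text \<open>
  \<open>v 0, \<dots>, v N\<close> are the states \<open>u\<^sub>0, \<dots>, u\<^sub>N\<close> and \<open>z 1, \<dots>, z N\<close> the strengths solving the
  generalized Riemann problem with widths \<open>w 1, \<dots>, w N\<close>.
\<close>

definition gRP :: "('n::finite) claw \<Rightarrow> (nat \<Rightarrow> real) \<Rightarrow> real^'n \<Rightarrow> real^'n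
    \<Rightarrow> (nat \<Rightarrow> real) \<Rightarrow> (nat \<Rightarrow> real^'n) \<Rightarrow> bool" where
  "gRP S w uL uR z v \<longleftrightarrow> v 0 = uL \<and>
     (\<forall>k\<in>fams S. if w k = 0 then shock_or_wave S k (v (k - 1)) (z k) (v k)
                 else simple_wave S k (v (k - 1)) (z k) (v k)) \<and>
     v (CARD('n)) = uR"

definition gRP_widths :: "('n::finite) claw \<Rightarrow> (nat \<Rightarrow> real) \<Rightarrow> bool" where
  "gRP_widths S w \<longleftrightarrow> (\<forall>k\<in>fams S. 0 \<le> w k \<and> (LD S k \<longrightarrow> w k = 0))"

text \<open>
  The \<open>C\<^sup>1\<close> regularity of the eigenvalues and eigenvectors is what makes \<open>\<nabla>\<lambda>\<^sub>k\<close> and the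
  flow \<open>W\<^sub>k\<close> well defined. In the clause on \<open>E\<^sub>k\<close> the shock curve through \<open>u\<close> is the image of a
  parameter interval \<open>Z\<close> with right end point \<open>0\<close>.
\<close>

definition conservation_law :: "('n::finite) claw \<Rightarrow> bool" where
  "conservation_law S \<longleftrightarrow>
     open (states S) \<and> compact (compact_states S) \<and> compact_states S \<subseteq> states S \<and>
     C2_on (states S) (qfun S) \<and> C2_on (states S) (ffun S) \<and>
     (\<forall>k\<in>fams S. C1_on (states S) (lam S k) \<and> C1_on (states S) (rvec S k)) \<and>
     (\<forall>k\<in>fams S. \<forall>u\<in>states S. rvec S k u \<noteq> 0 \<and>
        frechet_derivative (ffun S) (at u) (rvec S k u)
          = lam S k u *\<^sub>R frechet_derivative (qfun S) (at u) (rvec S k u)) \<and>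
     (\<forall>k\<in>fams S. \<forall>k'\<in>fams S. k < k' \<longrightarrow> (\<forall>u\<in>states S. lam S k u < lam S k' u)) \<and>
     (\<forall>k\<in>fams S. GNL S k \<or> LD S k) \<and>
     (\<forall>k\<in>fams S. \<forall>k'\<in>fams S. k < k' \<longrightarrow> (\<forall>ul um ur \<sigma> \<sigma>'.
        k_shock S k ul um \<sigma> \<and> k_shock S k' um ur \<sigma>' \<longrightarrow> \<sigma> < \<sigma>')) \<and>
     (\<forall>k\<in>fams S. \<forall>u\<in>states S. \<forall>\<zeta> u'. 0 \<le> \<zeta> \<or> LD S k \<longrightarrow>
        (shock_or_wave S k u \<zeta> u' \<longleftrightarrow> simple_wave S k u \<zeta> u')) \<and>
     (\<forall>k\<in>fams S. \<not> LD S k \<longrightarrow> (\<forall>u\<in>states S. \<exists>Z h.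
        is_interval Z \<and> Z \<subseteq> {..<0} \<and> 0 \<in> closure Z \<and>
        continuous_on Z h \<and> inj_on h Z \<and> (h \<longlongrightarrow> u) (at 0 within Z) \<and>
        h ` Z = {u'. \<exists>\<sigma>. k_shock S k u u' \<sigma>} \<and>
        (\<forall>\<zeta><0. \<forall>u'. shock_or_wave S k u \<zeta> u' \<longleftrightarrow> \<zeta> \<in> Z \<and> u' = h \<zeta>))) \<and>
     (\<forall>uL\<in>compact_states S. \<forall>uR\<in>compact_states S. \<forall>w. gRP_widths S w \<longrightarrow>
        (\<exists>z v. gRP S w uL uR z v \<and>
           (\<forall>z' v'. gRP S w uL uR z' v' \<longrightarrow> (\<forall>k\<in>fams S. z' k = z k))))"

section \<open>Parameters of the scheme\<close>

text \<open>
  \<open>prec_bd\<close> bounds the preconditioners and their inverses, \<open>sharp_bd\<close> is the constant in the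
  condition \<open>(t\<^sup>! - t\<^sup>c)/(t\<^sup># - t\<^sup>!) = O(m \<epsilon>^{e_r})\<close>, and \<open>[xleft, xright]\<close> is the compact interval
  on which the initial data are approximated.
\<close>

record mft_params =
  eps :: real
  exp_r :: real
  exp_c :: real
  exp_w :: real
  exp_p :: real
  exp_d :: real
  exp_i :: real
  kappa :: real
  Qfun :: "real \<Rightarrow> real"
  prec_bd :: real
  sharp_bd :: real
  xleft :: real
  xright :: real

definition scheme_params :: "mft_params \<Rightarrow> bool" where
  "scheme_params P \<longleftrightarrow> 0 < eps P \<and>
     0 < exp_r P \<and> 0 < exp_c P \<and> 0 < exp_w P \<and> 0 < exp_p P \<and> 0 < exp_d P \<and> 0 < exp_i P \<and>
     0 < kappa P \<and> kappa P < 1/3 \<and> eps P powr exp_p P < kappa P * eps P powr exp_r P \<and>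
     0 < Qfun P (eps P) \<and> Qfun P (eps P) < 1 \<and>
     0 < prec_bd P \<and> 0 < sharp_bd P \<and> xleft P < xright P"

section \<open>Waves and composite waves\<close>

datatype wave_type = Shock | Contact | Simple

text \<open>
  \<open>own_speed\<close> is the exact or least squares speed of the wave by itself; \<open>ctime\<close> is the time
  \<open>t\<^sup>c\<close> of the virtual center assigned to it when it is created. For a member of a
  multi-rarefaction, \<open>multi\<close> is \<open>Some (t\<^sup>#, \<lambda>\<^sub>k(ubar))\<close>.
\<close>

record ('n::finite) wave =
  fam :: nat
  str :: real
  lst :: "real^'n"
  rst :: "real^'n"
  wtype :: wave_type
  prec :: "real^'n^'n"
  own_speed :: real
  ctime :: real
  multi :: "(real \<times> real) option"

text \<open>
  A composite wave is a carrier with its passengers (possibly none), listed from left to right.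
  It issues from \<open>(xbirth, tbirth)\<close> at the interaction number \<open>origin\<close> (\<open>0\<close> for the initial waves),
  moves with speed \<open>tspeed\<close> up to time \<open>tsharp\<close> and with speed \<open>speed\<close> afterwards;
  \<open>(xcent, tcent)\<close> is its current virtual center.
\<close>

record ('n::finite) composite =
  members :: "'n wave list"
  carrier_ix :: nat
  origin :: nat
  tbirth :: real
  xbirth :: real
  speed :: real
  tspeed :: real
  tsharp :: real
  xcent :: real
  tcent :: real

text \<open>A wave sequence: the state left of all waves, and the waves in their order in space.\<close>

record ('n::finite) wave_seq =
  ubase :: "real^'n"
  comps :: "'n composite list"

definition carr :: "('n::finite) composite \<Rightarrow> 'n wave" where
  "carr c = members c ! carrier_ix c"

definition left_state :: "('n::finite) composite \<Rightarrow> real^'n" where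
  "left_state c = lst (hd (members c))"

definition right_state :: "('n::finite) composite \<Rightarrow> real^'n" where
  "right_state c = rst (last (members c))"

definition pos :: "('n::finite) composite \<Rightarrow> real \<Rightarrow> real" where
  "pos c t = xbirth c + tspeed c * (min t (tsharp c) - tbirth c)
                      + speed c * (max t (tsharp c) - tsharp c)"

definition dlam :: "('n::finite) claw \<Rightarrow> 'n wave \<Rightarrow> real" where
  "dlam S g = lam S (fam g) (rst g) - lam S (fam g) (lst g)"

definition width :: "('n::finite) claw \<Rightarrow> 'n composite \<Rightarrow> real \<Rightarrow> real" where
  "width S c t = (if wtype (carr c) = Simple then dlam S (carr c) * (t - tcent c) else 0)"

definition left_edge :: "('n::finite) claw \<Rightarrow> 'n composite \<Rightarrow> real \<Rightarrow> real" where
  "left_edge S c t = (if wtype (carr c) = Simple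
     then xcent c + lam S (fam (carr c)) (lst (carr c)) * (t - tcent c) else pos c t)"

definition right_edge :: "('n::finite) claw \<Rightarrow> 'n composite \<Rightarrow> real \<Rightarrow> real" where
  "right_edge S c t = (if wtype (carr c) = Simple
     then xcent c + lam S (fam (carr c)) (rst (carr c)) * (t - tcent c) else pos c t)"

definition all_waves :: "('n::finite) wave_seq \<Rightarrow> 'n wave list" where
  "all_waves \<Gamma> = concat (map members (comps \<Gamma>))"

definition variation :: "('n::finite) wave_seq \<Rightarrow> ennreal" where
  "variation \<Gamma> = (\<Sum>g\<leftarrow>all_waves \<Gamma>. ennreal \<bar>str g\<bar>)"

definition heaviside :: "real \<Rightarrow> real" where
  "heaviside x = (if x < 0 then 0 else if x = 0 then 1/2 else 1)"

definition approx :: "('n::finite) wave_seq \<Rightarrow> real \<Rightarrow> real \<Rightarrow> real^'n" where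
  "approx \<Gamma> t x = ubase \<Gamma> +
     (\<Sum>c\<leftarrow>comps \<Gamma>. \<Sum>g\<leftarrow>members c. heaviside (x - pos c t) *\<^sub>R (rst g - lst g))"

subsection \<open>Speeds\<close>

definition least_squares_speed :: "('n::finite) claw \<Rightarrow> 'n wave list \<Rightarrow> real \<Rightarrow> bool" where
  "least_squares_speed S gs s \<longleftrightarrow> is_arg_min
     (\<lambda>s. norm (\<Sum>g\<leftarrow>gs. prec g *v
        ((ffun S (rst g) - ffun S (lst g)) - s *\<^sub>R (qfun S (rst g) - qfun S (lst g)))))
     (\<lambda>_. True) s"

definition wave_ok :: "('n::finite) claw \<Rightarrow> mft_params \<Rightarrow> 'n wave \<Rightarrow> bool" where
  "wave_ok S P g \<longleftrightarrow> fam g \<in> fams S \<and> str g \<noteq> 0 \<and>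
     invertible (prec g) \<and> onorm ((*v) (prec g)) \<le> prec_bd P \<and>
     onorm ((*v) (matrix_inv (prec g))) \<le> prec_bd P \<and>
     (case wtype g of
        Shock \<Rightarrow> shock_or_wave S (fam g) (lst g) (str g) (rst g) \<and>
                 k_shock S (fam g) (lst g) (rst g) (own_speed g)
      | Contact \<Rightarrow> shock_or_wave S (fam g) (lst g) (str g) (rst g) \<and>
                 own_speed g = lam S (fam g) (lst g)
      | Simple \<Rightarrow> simple_wave S (fam g) (lst g) (str g) (rst g) \<and>
                 least_squares_speed S [g] (own_speed g))"

definition common_speed :: "('n::finite) claw \<Rightarrow> mft_params \<Rightarrow> 'n composite \<Rightarrow> real \<Rightarrow> bool" where
  "common_speed S P c s \<longleftrightarrow>
     (if \<forall>i<length (members c). i \<noteq> carrier_ix c \<longrightarrow>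
           \<bar>str (members c ! i)\<bar> \<le> Qfun P (eps P) * \<bar>str (carr c)\<bar>
      then s = own_speed (carr c)
      else least_squares_speed S (members c) s)"

text \<open>
  The composite wave \<open>c\<close> issues from \<open>(x, t)\<close>. The virtual center lies on the line of motion of the
  wave; for a multi-rarefaction this is the line followed after \<open>t\<^sup>#\<close>, and all pieces share the
  center of the whole rarefaction, which moves from there with speed \<open>\<lambda>\<^sub>k(ubar)\<close>.
\<close>

definition issues :: "('n::finite) claw \<Rightarrow> mft_params \<Rightarrow> nat \<Rightarrow> real \<Rightarrow> real \<Rightarrow> 'n composite \<Rightarrow> bool" where
  "issues S P n x t c \<longleftrightarrow>
     origin c = n \<and> tbirth c = t \<and> xbirth c = x \<and> common_speed S P c (speed c) \<and>
     tcent c = ctime (carr c) \<and>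
     (case multi (carr c) of
        None \<Rightarrow> tspeed c = speed c \<and> tsharp c = t \<and> xcent c = x - speed c * (t - tcent c)
      | Some (ts, lbar) \<Rightarrow> tsharp c = ts \<and>
          (tspeed c - speed c) * (ts - t) = (speed c - lbar) * (t - tcent c) \<and>
          xcent c = x - lbar * (t - tcent c))"

subsection \<open>Waves solving a generalized Riemann problem\<close>

definition gRP_wave_type :: "('n::finite) claw \<Rightarrow> nat \<Rightarrow> real \<Rightarrow> real \<Rightarrow> wave_type" where
  "gRP_wave_type S k w \<zeta> = (if LD S k then Contact else if w = 0 \<and> \<zeta> < 0 then Shock else Simple)"

fun wave_chain :: "real^'n \<Rightarrow> 'n::finite wave list \<Rightarrow> real^'n \<Rightarrow> bool" where
  "wave_chain u [] u' \<longleftrightarrow> u = u'"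
| "wave_chain u (g # gs) u' \<longleftrightarrow> lst g = u \<and> wave_chain (rst g) gs u'"

definition unsplit_wave :: "('n::finite) claw \<Rightarrow> mft_params \<Rightarrow> (nat \<Rightarrow> real) \<Rightarrow> (nat \<Rightarrow> real)
    \<Rightarrow> (nat \<Rightarrow> real^'n) \<Rightarrow> nat \<Rightarrow> 'n wave \<Rightarrow> bool" where
  "unsplit_wave S P w z v k g \<longleftrightarrow> wave_ok S P g \<and> fam g = k \<and> str g = z k \<and>
     lst g = v (k - 1) \<and> rst g = v k \<and> wtype g = gRP_wave_type S k (w k) (z k) \<and> multi g = None"

definition split_along :: "('n::finite) claw \<Rightarrow> mft_params \<Rightarrow> nat \<Rightarrow> real^'n \<Rightarrow> real \<Rightarrow> real^'n
    \<Rightarrow> 'n wave list \<Rightarrow> bool" where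
  "split_along S P k u \<zeta> u' gs \<longleftrightarrow> wave_chain u gs u' \<and> sum_list (map str gs) = \<zeta> \<and>
     (\<forall>g\<in>set gs. wave_ok S P g \<and> fam g = k \<and> wtype g = Simple \<and> 0 < str g)"

definition center_time :: "('n::finite) claw \<Rightarrow> real \<Rightarrow> real \<Rightarrow> 'n wave \<Rightarrow> real" where
  "center_time S t w g = (if wtype g = Simple then t - w / dlam S g else t)"

text \<open>
  The waves of family \<open>k\<close> issuing at time \<open>t\<close> from an interaction, in the solution \<open>(z, v)\<close> with
  widths \<open>w\<close>; a vanishing strength gives no wave.
\<close>

definition outgoing_k :: "('n::finite) claw \<Rightarrow> mft_params \<Rightarrow> real \<Rightarrow> (nat \<Rightarrow> real) \<Rightarrow> (nat \<Rightarrow> real)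
    \<Rightarrow> (nat \<Rightarrow> real^'n) \<Rightarrow> nat \<Rightarrow> 'n wave list \<Rightarrow> bool" where
  "outgoing_k S P t w z v k gs \<longleftrightarrow>
     (if z k = 0 then gs = []
      else if LD S k \<or> z k \<le> eps P powr exp_r P then
        (\<exists>g. gs = [g] \<and> unsplit_wave S P w z v k g \<and> ctime g = center_time S t (w k) g)
      else split_along S P k (v (k - 1)) (z k) (v k) gs \<and>
        (\<forall>g\<in>set gs. kappa P * eps P powr exp_r P \<le> str g \<and> str g \<le> eps P powr exp_r P) \<and>
        (if w k = 0 then
           sorted_wrt (<) (map own_speed gs) \<and> (\<forall>g\<in>set gs. ctime g = t \<and> multi g = None)
         else
           (\<exists>m ubar tc ts. length gs = 2 * m + 1 \<and> map str gs = rev (map str gs) \<and>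
              simple_wave S k (v (k - 1)) (z k / 2) ubar \<and>
              tc = t - w k / (lam S k (v k) - lam S k (v (k - 1))) \<and>
              t < ts \<and> (t - tc) / (ts - t) \<le> sharp_bd P * real m * eps P powr exp_r P \<and>
              (\<forall>g\<in>set gs. ctime g = tc \<and> multi g = Some (ts, lam S k ubar)))))"

text \<open>The same for a Riemann problem in the initial data, where all widths are \<open>0\<close>.\<close>

definition initial_RP_k :: "('n::finite) claw \<Rightarrow> mft_params \<Rightarrow> (nat \<Rightarrow> real)
    \<Rightarrow> (nat \<Rightarrow> real^'n) \<Rightarrow> nat \<Rightarrow> 'n wave list \<Rightarrow> bool" where
  "initial_RP_k S P z v k gs \<longleftrightarrow>
     (if z k = 0 then gs = []
      else if LD S k \<or> z k < 0 then
        (\<exists>g. gs = [g] \<and> unsplit_wave S P (\<lambda>_. 0) z v k g \<and> ctime g = 0)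
      else split_along S P k (v (k - 1)) (z k) (v k) gs \<and>
        (\<forall>g\<in>set gs. str g < eps P powr exp_r P \<and> ctime g = 0 \<and> multi g = None))"

subsection \<open>Grouping into composite waves\<close>

definition is_base :: "mft_params \<Rightarrow> ('n::finite) wave \<Rightarrow> bool" where
  "is_base P g \<longleftrightarrow> eps P powr exp_p P \<le> \<bar>str g\<bar>"

definition grouping :: "mft_params \<Rightarrow> ('n::finite) wave list \<Rightarrow> 'n composite list \<Rightarrow> bool" where
  "grouping P gs cs \<longleftrightarrow> concat (map members cs) = gs \<and>
     (\<forall>c\<in>set cs. carrier_ix c < length (members c)) \<and>
     (if \<exists>g\<in>set gs. is_base P g then
        (\<forall>c\<in>set cs. \<forall>i<length (members c). is_base P (members c ! i) \<longleftrightarrow> i = carrier_ix c) \<and>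
        (\<forall>j. Suc j < length cs \<longrightarrow>
           (let a = cs ! j; b = cs ! Suc j in
             \<comment> \<open>\<open>a\<close> has a passenger to the right of its carrier\<close>
             (Suc (carrier_ix a) < length (members a) \<longrightarrow> \<bar>str (carr b)\<bar> \<le> \<bar>str (carr a)\<bar>) \<and>
             \<comment> \<open>\<open>b\<close> has a passenger to the left of its carrier\<close>
             (0 < carrier_ix b \<longrightarrow> \<bar>str (carr a)\<bar> \<le> \<bar>str (carr b)\<bar>)))
      else length cs \<le> 1 \<and> (\<forall>c\<in>set cs. \<forall>g\<in>set gs. \<bar>str g\<bar> \<le> \<bar>str (carr c)\<bar>))"

section \<open>Interactions\<close>

text \<open>
  Neighbouring waves which have just issued from the same point at the same interaction
  are not counted as meeting there.
\<close>

definition meets :: "('n::finite) composite \<Rightarrow> 'n composite \<Rightarrow> real \<Rightarrow> bool" where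
  "meets a b t \<longleftrightarrow> pos a t = pos b t \<and>
     \<not> (tbirth a = t \<and> tbirth b = t \<and> origin a = origin b)"

definition collapses :: "('n::finite) claw \<Rightarrow> 'n composite \<Rightarrow> real \<Rightarrow> bool" where
  "collapses S a t \<longleftrightarrow> wtype (carr a) = Simple \<and> str (carr a) < 0 \<and> width S a t = 0"

definition interacting :: "('n::finite) claw \<Rightarrow> 'n composite list \<Rightarrow> real \<Rightarrow> bool" where
  "interacting S inc t \<longleftrightarrow>
     (\<exists>a b. inc = [a, b] \<and> meets a b t) \<or> (\<exists>a. inc = [a] \<and> collapses S a t)"

definition has_interaction :: "('n::finite) claw \<Rightarrow> 'n wave_seq \<Rightarrow> real \<Rightarrow> bool" where
  "has_interaction S \<Gamma> t \<longleftrightarrow> (\<exists>pre inc post. comps \<Gamma> = pre @ inc @ post \<and> interacting S inc t)"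

definition width_rule :: "('n::finite) claw \<Rightarrow> 'n composite list \<Rightarrow> real \<Rightarrow> (nat \<Rightarrow> real) \<Rightarrow> bool" where
  "width_rule S inc t w \<longleftrightarrow> gRP_widths S w \<and>
     (case inc of
        [a, b] \<Rightarrow>
          (let ka = fam (carr a); kb = fam (carr b); wa = width S a t; wb = width S b t in
            (\<forall>k\<in>fams S - {ka, kb}. w k \<le> max wa wb) \<and>
            (if ka = kb then w ka = 0 else w ka \<le> wa \<and> w kb \<le> wb))
      | _ \<Rightarrow> (\<forall>k\<in>fams S. w k = 0))"

definition bad_compressions :: "('n::finite) claw \<Rightarrow> mft_params \<Rightarrow> (nat \<Rightarrow> real) \<Rightarrow> (nat \<Rightarrow> real) \<Rightarrow> nat set" where
  "bad_compressions S P w z = {k \<in> fams S. 0 < w k \<and> z k < 0 \<and>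
     z k \<notin> {- (eps P powr exp_c P) .. - (eps P powr exp_w P)}}"

text \<open>Starting from widths \<open>w\<close>, repeated resetting ends with widths \<open>w'\<close> and solution \<open>(z, v)\<close>.\<close>

inductive resolves :: "('n::finite) claw \<Rightarrow> mft_params \<Rightarrow> real^'n \<Rightarrow> real^'n \<Rightarrow> (nat \<Rightarrow> real)
    \<Rightarrow> (nat \<Rightarrow> real) \<Rightarrow> (nat \<Rightarrow> real) \<Rightarrow> (nat \<Rightarrow> real^'n) \<Rightarrow> bool"
  for S P uL uR where
  good: "gRP S w uL uR z v \<Longrightarrow> bad_compressions S P w z = {} \<Longrightarrow> resolves S P uL uR w w z v"
| reset: "gRP S w uL uR z v \<Longrightarrow> B \<noteq> {} \<Longrightarrow> B \<subseteq> bad_compressions S P w z \<Longrightarrow>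
    resolves S P uL uR (\<lambda>k. if k \<in> B then 0 else w k) w' z' v' \<Longrightarrow> resolves S P uL uR w w' z' v'"

text \<open>
  Give \<open>c\<close> the virtual width \<open>w\<close> at time \<open>t\<close>, keeping its motion: the new center is the point of the
  same center line at which the virtual edges, now at distance \<open>w\<close>, meet.
\<close>

definition with_width :: "('n::finite) claw \<Rightarrow> real \<Rightarrow> real \<Rightarrow> 'n composite \<Rightarrow> 'n composite" where
  "with_width S t w c =
     (let tc = t - w / dlam S (carr c)
      in c\<lparr>tcent := tc, xcent := xcent c + speed c * (tc - tcent c)\<rparr>)"

definition reduced_width :: "('n::finite) claw \<Rightarrow> real \<Rightarrow> 'n composite \<Rightarrow> 'n composite \<Rightarrow> bool" where
  "reduced_width S t c c' \<longleftrightarrow> (\<exists>w \<le> width S c t. (0 < w \<or> w = width S c t) \<and> c' = with_width S t w c)"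

definition avoid_overlap :: "('n::finite) claw \<Rightarrow> real \<Rightarrow> 'n composite \<Rightarrow> 'n composite
    \<Rightarrow> 'n composite \<Rightarrow> 'n composite \<Rightarrow> bool" where
  "avoid_overlap S t a b a' b' \<longleftrightarrow>
     (if wtype (carr a) = Simple \<and> wtype (carr b) = Simple \<and> fam (carr a) = fam (carr b) \<and>
         left_edge S b t < right_edge S a t
      then reduced_width S t a a' \<and> reduced_width S t b b' \<and> right_edge S a' t \<le> left_edge S b' t
      else a' = a \<and> b' = b)"

definition fix_overlap :: "('n::finite) claw \<Rightarrow> real \<Rightarrow> 'n composite list \<Rightarrow> 'n composite list
    \<Rightarrow> 'n composite list \<Rightarrow> 'n composite list \<Rightarrow> bool" where
  "fix_overlap S t as bs as' bs' \<longleftrightarrow>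
     (if as = [] \<or> bs = [] then as' = as \<and> bs' = bs
      else \<exists>a' b'. avoid_overlap S t (last as) (hd bs) a' b' \<and>
             as' = butlast as @ [a'] \<and> bs' = b' # tl bs)"

definition mft_step :: "('n::finite) claw \<Rightarrow> mft_params \<Rightarrow> nat \<Rightarrow> real \<Rightarrow> 'n wave_seq \<Rightarrow> 'n wave_seq \<Rightarrow> bool" where
  "mft_step S P n t \<Gamma> \<Gamma>' \<longleftrightarrow>
     (\<exists>pre inc post w0 w z v gss outs pre' outs1 outs2 post'.
        comps \<Gamma> = pre @ inc @ post \<and> interacting S inc t \<and>
        width_rule S inc t w0 \<and>
        resolves S P (left_state (hd inc)) (right_state (last inc)) w0 w z v \<and>
        (\<forall>k\<in>fams S. outgoing_k S P t w z v k (gss k)) \<and>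
        grouping P (concat (map gss [1..<Suc CARD('n)])) outs \<and>
        (\<forall>c\<in>set outs. issues S P n (pos (hd inc) t) t c) \<and>
        fix_overlap S t pre outs pre' outs1 \<and> fix_overlap S t outs1 post outs2 post' \<and>
        \<Gamma>' = \<lparr>ubase = ubase \<Gamma>, comps = pre' @ outs2 @ post'\<rparr>)"

section \<open>Function spaces\<close>

text \<open>
  \<open>X R\<close> is the normed space of test elements supported in \<open>[-R, R]\<close>; the test space is the union of the
  \<open>X R\<close> with the inductive limit topology, and \<open>local_dual X\<close> is its dual.
\<close>

definition local_dual :: "(real \<Rightarrow> 'x::real_normed_vector set) \<Rightarrow> ('x \<Rightarrow> real) set" where
  "local_dual X = {l. \<forall>R. (\<forall>x\<in>X R. \<forall>y\<in>X R. \<forall>a b. l (a *\<^sub>R x + b *\<^sub>R y) = a * l x + b * l y) \<and>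
                         (\<exists>C. \<forall>x\<in>X R. \<bar>l x\<bar> \<le> C * norm x)}"

text \<open>\<open>L\<^sup>\<infinity>\<^sub>*(0, \<tau>; X\<^sup>*)\<close>: weak* measurable functions with essentially bounded (local) dual norms.\<close>

definition Linf_star :: "real \<Rightarrow> (real \<Rightarrow> 'x::real_normed_vector set) \<Rightarrow> (real \<Rightarrow> 'x \<Rightarrow> real) set" where
  "Linf_star \<tau> X = {l. (\<forall>t\<in>{0<..<\<tau>}. l t \<in> local_dual X) \<and>
     (\<forall>R. \<forall>x\<in>X R. (\<lambda>t. l t x) \<in> borel_measurable (lebesgue_on {0<..<\<tau>})) \<and>
     (\<forall>R. \<exists>C. AE t in lebesgue_on {0<..<\<tau>}. \<forall>x\<in>X R. \<bar>l t x\<bar> \<le> C * norm x)}"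

definition C00 :: "real \<Rightarrow> (real \<Rightarrow>\<^sub>C (real^'n::finite)) set" where
  "C00 R = {\<phi>. \<forall>x. \<bar>x\<bar> > R \<longrightarrow> apply_bcontfun \<phi> x = 0}"

text \<open>
  The predual of \<open>BV\<close> consists of the distributions \<open>\<phi> + \<psi>'\<close> with \<open>\<phi>, \<psi> \<in> C\<^sub>0\<^sup>0\<close>, represented here by
  the pairs \<open>(\<phi>, \<psi>)\<close>; such a pair acts on \<open>u \<in> BV\<close> by \<open>\<integral>u \<bullet> \<phi> - \<langle>Du, \<psi>\<rangle>\<close>.
\<close>

definition Cm1 :: "real \<Rightarrow> ((real \<Rightarrow>\<^sub>C (real^'n::finite)) \<times> (real \<Rightarrow>\<^sub>C (real^'n))) set" where
  "Cm1 R = C00 R \<times> C00 R"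

abbreviation M_loc :: "((real \<Rightarrow>\<^sub>C (real^'n::finite)) \<Rightarrow> real) set" where
  "M_loc \<equiv> local_dual C00"

definition fun_pairing :: "(real \<Rightarrow> real^'n::finite) \<Rightarrow> (real \<Rightarrow>\<^sub>C (real^'n)) \<Rightarrow> real" where
  "fun_pairing u \<phi> = (LINT x|lebesgue. u x \<bullet> apply_bcontfun \<phi> x)"

definition derivative_measure :: "(real \<Rightarrow> real^'n::finite) \<Rightarrow> ((real \<Rightarrow>\<^sub>C (real^'n)) \<Rightarrow> real) \<Rightarrow> bool" where
  "derivative_measure u \<mu> \<longleftrightarrow> \<mu> \<in> M_loc \<and>
     (\<forall>R. \<forall>\<psi>\<in>C00 R. \<forall>\<psi>'\<in>C00 R.
        (\<forall>x. (apply_bcontfun \<psi> has_vector_derivative apply_bcontfun \<psi>' x) (at x)) \<longrightarrow>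
        \<mu> \<psi> = - fun_pairing u \<psi>')"

definition BV_loc :: "(real \<Rightarrow> real^'n::finite) set" where
  "BV_loc = {u. (\<forall>a b. u absolutely_integrable_on {a..b}) \<and> (\<exists>\<mu>. derivative_measure u \<mu>)}"

definition BV_pairing :: "(real \<Rightarrow> real^'n::finite) \<Rightarrow> ((real \<Rightarrow>\<^sub>C (real^'n)) \<Rightarrow> real)
    \<Rightarrow> (real \<Rightarrow>\<^sub>C (real^'n)) \<times> (real \<Rightarrow>\<^sub>C (real^'n)) \<Rightarrow> real" where
  "BV_pairing u \<mu> = (\<lambda>(\<phi>, \<psi>). fun_pairing u \<phi> - \<mu> \<psi>)"

definition Linf_BV :: "real \<Rightarrow> (real \<Rightarrow> real \<Rightarrow> real^'n::finite) set" where
  "Linf_BV \<tau> = {u. (\<forall>t\<in>{0<..<\<tau>}. u t \<in> BV_loc) \<and>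
     (\<exists>\<mu>. (\<forall>t\<in>{0<..<\<tau>}. derivative_measure (u t) (\<mu> t)) \<and>
          (\<lambda>t. BV_pairing (u t) (\<mu> t)) \<in> Linf_star \<tau> Cm1)}"

definition test_fun :: "real \<Rightarrow> (real \<Rightarrow> real) set" where
  "test_fun \<tau> = {\<eta>. (\<forall>n x. (deriv ^^ n) \<eta> field_differentiable (at x)) \<and>
     (\<exists>a b. 0 < a \<and> b < \<tau> \<and> (\<forall>t. t \<notin> {a..b} \<longrightarrow> \<eta> t = 0))}"

text \<open>
  \<open>W\<^sup>1\<^sup>,\<^sup>\<infinity>\<^sub>*(0, \<tau>; BV_loc, M_loc)\<close>. The Gelfand-weak derivative is tested against \<open>\<eta>(t) \<phi>(x)\<close>, since a
  Gelfand integral in \<open>M_loc\<close> is determined by its pairings with \<open>\<phi> \<in> C\<^sub>0\<^sup>0\<close>.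
\<close>

definition W1inf :: "real \<Rightarrow> (real \<Rightarrow> real \<Rightarrow> real^'n::finite) set" where
  "W1inf \<tau> = {u. u \<in> Linf_BV \<tau> \<and>
     (\<exists>u' \<in> Linf_star \<tau> C00. \<forall>\<eta>\<in>test_fun \<tau>. \<forall>R. \<forall>\<phi>\<in>C00 R.
        (LINT t|lebesgue_on {0<..<\<tau>}. deriv \<eta> t * fun_pairing (u t) \<phi>)
          = - (LINT t|lebesgue_on {0<..<\<tau>}. \<eta> t * u' t \<phi>))}"

definition Z_space :: "('n::finite) claw \<Rightarrow> real \<Rightarrow> (real \<Rightarrow> real \<Rightarrow> real^'n) set" where
  "Z_space S \<tau> = {u. (\<forall>t\<in>{0<..<\<tau>}. AE x in lebesgue. u t x \<in> states S) \<and>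
     (\<lambda>t x. ffun S (u t x)) \<in> Linf_BV \<tau> \<and> (\<lambda>t x. qfun S (u t x)) \<in> W1inf \<tau>}"

section \<open>Initialization\<close>

text \<open>Since \<open>u\<^sup>o \<in> BV_loc\<close> is only determined almost everywhere, its one-sided limits are essential limits.\<close>

definition left_lim :: "(real \<Rightarrow> real^'n::finite) \<Rightarrow> real \<Rightarrow> real^'n \<Rightarrow> bool" where
  "left_lim u x l \<longleftrightarrow> (\<forall>e>0. \<exists>d>0. AE y in lebesgue. x - d < y \<and> y < x \<longrightarrow> dist (u y) l < e)"

definition right_lim :: "(real \<Rightarrow> real^'n::finite) \<Rightarrow> real \<Rightarrow> real^'n \<Rightarrow> bool" where
  "right_lim u x l \<longleftrightarrow> (\<forall>e>0. \<exists>d>0. AE y in lebesgue. x < y \<and> y < x + d \<longrightarrow> dist (u y) l < e)"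

text \<open>Total variation \<open>|Du|((a, b))\<close> of a function in \<open>BV_loc\<close>.\<close>

definition total_var :: "(real \<Rightarrow> real^'n::finite) \<Rightarrow> real \<Rightarrow> real \<Rightarrow> real" where
  "total_var u a b = Sup {fun_pairing u \<psi>' | \<psi> \<psi>'. 
     (\<forall>x. (apply_bcontfun \<psi> has_vector_derivative apply_bcontfun \<psi>' x) (at x)) \<and>
     (\<exists>c d. a < c \<and> d < b \<and> (\<forall>x. x \<notin> {c..d} \<longrightarrow> apply_bcontfun \<psi> x = 0)) \<and>
     (\<forall>x. norm (apply_bcontfun \<psi> x) \<le> 1)}"

text \<open>
  Single jumps replacing the generalized Riemann solution in \<open>(a, b)\<close>: the virtual intervals at time
  \<open>0\<close> are contained in \<open>(a, b)\<close>, disjoint, and of width at most \<open>w k\<close>.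
\<close>

definition initial_interval :: "('n::finite) claw \<Rightarrow> mft_params \<Rightarrow> real \<Rightarrow> real \<Rightarrow> real^'n \<Rightarrow> real^'n
    \<Rightarrow> 'n composite list \<Rightarrow> bool" where
  "initial_interval S P a b uL uR cs \<longleftrightarrow>
     (\<exists>w z v. gRP_widths S w \<and> (\<forall>k\<in>fams S. \<not> LD S k \<longrightarrow> 0 < w k) \<and>
        (\<Sum>k\<in>fams S. w k) < b - a \<and> gRP S w uL uR z v \<and>
        list_all2 (\<lambda>c k. \<exists>g. members c = [g] \<and> carrier_ix c = 0 \<and>
            unsplit_wave S P w z v k g \<and>
            (\<exists>w' \<le> w k. (wtype g = Simple \<longrightarrow> 0 < w') \<and> ctime g = center_time S 0 w' g) \<and>
            issues S P 0 (xbirth c) 0 c \<and> a < xbirth c \<and> xbirth c < b \<and>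
            a < left_edge S c 0 \<and> right_edge S c 0 < b)
          cs (filter (\<lambda>k. z k \<noteq> 0) [1..<Suc CARD('n)]) \<and>
        (\<forall>i. Suc i < length cs \<longrightarrow> right_edge S (cs ! i) 0 \<le> left_edge S (cs ! Suc i) 0))"

definition initial_RP :: "('n::finite) claw \<Rightarrow> mft_params \<Rightarrow> real \<Rightarrow> real^'n \<Rightarrow> real^'n
    \<Rightarrow> 'n composite list \<Rightarrow> bool" where
  "initial_RP S P x uL uR cs \<longleftrightarrow>
     (\<exists>z v gss. gRP S (\<lambda>_. 0) uL uR z v \<and> (\<forall>k\<in>fams S. initial_RP_k S P z v k (gss k)) \<and>
        grouping P (concat (map gss [1..<Suc CARD('n)])) cs \<and> (\<forall>c\<in>set cs. issues S P 0 x 0 c))"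

text \<open>
  \<open>xs\<close> is the list of all points used, \<open>l j\<close> and \<open>r j\<close> are the limits of \<open>u\<^sup>o\<close> at \<open>xs ! j\<close> from the left
  and right. Points of \<open>xs\<close> at which no Riemann problem is solved are continuity points of \<open>u\<^sup>o\<close>.
  The \<open>BV\<close> error is the variation lost by sampling \<open>u\<^sup>o\<close> at the chosen points.
\<close>

definition mft_init :: "('n::finite) claw \<Rightarrow> mft_params \<Rightarrow> (real \<Rightarrow> real^'n) \<Rightarrow> 'n wave_seq \<Rightarrow> bool" where
  "mft_init S P uo \<Gamma> \<longleftrightarrow>
     (\<exists>xs l r ivl pts. let m = length xs - 1 in
        1 \<le> m \<and> sorted_wrt (<) xs \<and> hd xs = xleft P \<and> last xs = xright P \<and>
        (\<forall>j<m. right_lim uo (xs ! j) (r j)) \<and> (\<forall>j\<in>{1..m}. left_lim uo (xs ! j) (l j)) \<and>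
        (\<forall>y\<in>{xleft P<..<xright P}. \<forall>a b. left_lim uo y a \<and> right_lim uo y b \<and>
            eps P powr exp_d P \<le> norm (b - a) \<longrightarrow> y \<in> set xs) \<and>
        (\<forall>j\<in>{1..m}. initial_interval S P (xs ! (j - 1)) (xs ! j) (r (j - 1)) (l j) (ivl j)) \<and>
        (\<forall>j\<in>{1..<m}. if eps P powr exp_d P \<le> norm (r j - l j)
            then initial_RP S P (xs ! j) (l j) (r j) (pts j) else r j = l j \<and> pts j = []) \<and>
        pts m = [] \<and>
        \<Gamma> = \<lparr>ubase = r 0, comps = concat (map (\<lambda>j. ivl j @ pts j) [1..<Suc m])\<rparr> \<and>
        (\<Sum>j=1..m. total_var uo (xs ! (j - 1)) (xs ! j) - norm (l j - r (j - 1)))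
          < eps P powr exp_i P \<and>
        (LINT x:{xleft P..xright P}|lebesgue. norm (approx \<Gamma> 0 x - uo x)) < eps P powr exp_i P)"

section \<open>The modified Front Tracking scheme\<close>

text \<open>
  \<open>tt i\<close> is the \<open>i\<close>-th interaction time, with \<open>tt 0 = 0\<close>, and \<open>\<Gamma> i\<close> is the wave sequence following the
  \<open>i\<close>-th interaction, so \<open>\<Gamma>\<^sup>t = \<Gamma> i\<close> for \<open>tt i \<le> t < tt (Suc i)\<close>. If there is no further interaction
  before the time horizon \<open>T\<close>, the remaining \<open>tt\<close> are set to \<open>T\<close>. Simultaneous interactions
  are processed one at a time.
\<close>

definition mft_run :: "('n::finite) claw \<Rightarrow> mft_params \<Rightarrow> (real \<Rightarrow> real^'n) \<Rightarrow> real
    \<Rightarrow> (nat \<Rightarrow> real) \<Rightarrow> (nat \<Rightarrow> 'n wave_seq) \<Rightarrow> bool" where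
  "mft_run S P uo T tt \<Gamma> \<longleftrightarrow> tt 0 = 0 \<and> 0 < tt 1 \<and> mft_init S P uo (\<Gamma> 0) \<and>
     (\<forall>i. tt i \<le> tt (Suc i) \<and> tt i \<le> T \<and>
        (\<forall>t. tt i \<le> t \<and> t < tt (Suc i) \<longrightarrow> \<not> has_interaction S (\<Gamma> i) t) \<and>
        (tt (Suc i) < T \<longrightarrow> mft_step S P (Suc i) (tt (Suc i)) (\<Gamma> i) (\<Gamma> (Suc i)))) \<and>
     (\<forall>i. tt i < T \<longrightarrow>
        (\<forall>t\<in>{tt i..<tt (Suc i)}. sorted (map (\<lambda>c. pos c t) (comps (\<Gamma> i)))) \<and>
        ubase (\<Gamma> i) \<in> compact_states S \<and>
        (\<forall>g\<in>set (all_waves (\<Gamma> i)). lst g \<in> compact_states S \<and> rst g \<in> compact_states S)) \<and>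
     (\<exists>R. \<forall>i. \<forall>t\<in>{tt i..<tt (Suc i)}. \<forall>c\<in>set (comps (\<Gamma> i)). \<bar>pos c t\<bar> \<le> R)"

definition mft_approx :: "(nat \<Rightarrow> real) \<Rightarrow> (nat \<Rightarrow> ('n::finite) wave_seq) \<Rightarrow> real \<Rightarrow> real \<Rightarrow> real^'n" where
  "mft_approx tt \<Gamma> t x = approx (\<Gamma> (THE i. tt i \<le> t \<and> t < tt (Suc i))) t x"

end

theory Submission
  imports Defs
begin

text \<open>
  Between two interactions there are finitely many fronts, each moving continuously with at most two
  constant speeds, and \<open>U\<^sup>\<epsilon>\<close> is a step function in \<open>x\<close> whose jumps do not depend on \<open>t\<close>. Finiteness
  of the variation is therefore immediate; the substance of the theorem is the Gelfand regularity of
  \<open>U\<^sup>\<epsilon>\<close>, \<open>f(U\<^sup>\<epsilon>)\<close> and \<open>q(U\<^sup>\<epsilon>)\<close>.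

  All three have the same form. For an arbitrary function \<open>g\<close> of the state, \<open>g(U\<^sup>\<epsilon>)\<close> agrees almost
  everywhere with \<open>g(u\<^sub>0) + \<Sum> H(x - x\<^sub>k(t)) [g]\<^sub>k\<close>, where \<open>[g]\<^sub>k\<close> is the jump of \<open>g\<close> across the \<open>k\<close>-th
  composite wave. This holds because the waves are ordered in space and form a chain, the right state
  of each being the left state of the next: away from the fronts the sum telescopes and yields \<open>g(s)\<close>
  for one of the wave states \<open>s\<close> (\<open>front_sum_sorted\<close>). The chain property survives every interaction,
  since the outgoing waves solve a generalized Riemann problem between the outer states of the
  incoming ones.

  For a test function \<open>\<phi>\<close> with primitive \<open>\<Phi>\<close>, the pairing of such a step function with \<open>\<phi>\<close> is
  \<open>const - \<Sum> [g]\<^sub>k \<bullet> \<Phi>(x\<^sub>k(t))\<close>. Hence it is continuous in time and has, off finitely many times, the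
  derivative \<open>- \<Sum> s\<^sub>k [g]\<^sub>k \<bullet> \<phi>(x\<^sub>k(t))\<close>, that is, the pairing of \<open>\<phi>\<close> with a finite sum of Dirac masses;
  the total mass is bounded by the front speeds and jumps. No mass concentrates at an interaction time:
  all incoming and outgoing fronts are then at one point, and their jumps have the same sum, so the two
  step functions coincide (\<open>mft_step_linked\<close>). The fundamental theorem of calculus on each time slot and
  telescoping over the slots then give the weak time derivative (\<open>integration_by_parts\<close>,
  \<open>u_W1inf\<close>). Taking for \<open>g\<close> the identity, \<open>f\<close> and \<open>q\<close> proves the theorem.
\<close>

section \<open>Step functions and their distributional derivatives\<close>

definition step_fun :: "'v::real_vector \<Rightarrow> nat \<Rightarrow> (nat \<Rightarrow> real) \<Rightarrow> (nat \<Rightarrow> 'v) \<Rightarrow> real \<Rightarrow> 'v" where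
  "step_fun b n p a x = b + (\<Sum>k<n. heaviside (x - p k) *\<^sub>R a k)"

lemma heaviside_measurable [measurable]: "heaviside \<in> borel_measurable borel"
  unfolding heaviside_def [abs_def] by measurable

lemma heaviside_bounds: "0 \<le> heaviside x" "heaviside x \<le> 1"
  by (auto simp: heaviside_def)

lemma step_fun_measurable [measurable]:
  fixes b :: "real^'n::finite"
  shows "step_fun b n p a \<in> borel_measurable borel"
  unfolding step_fun_def [abs_def] by measurable

lemma norm_step_fun_le: "norm (step_fun b n p a x) \<le> norm b + (\<Sum>k<n. norm (a k))"
proof -
  have "norm (\<Sum>k<n. heaviside (x - p k) *\<^sub>R a k) \<le> (\<Sum>k<n. norm (a k))"
    by (intro sum_norm_le) (simp add: heaviside_bounds mult_left_le_one_le)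
  then show ?thesis
    unfolding step_fun_def by (meson add_left_mono norm_triangle_le)
qed

lemma bcontfun_measurable [measurable]:
  "apply_bcontfun (\<phi> :: real \<Rightarrow>\<^sub>C (real^'n::finite)) \<in> borel_measurable borel"
  by (intro borel_measurable_continuous_onI) auto

lemma C00_eq_0: "\<phi> \<in> C00 R \<Longrightarrow> \<bar>x\<bar> > R \<Longrightarrow> apply_bcontfun \<phi> x = 0"
  by (simp add: C00_def)

text \<open>
  The indicator of the support turns the pointwise Cauchy-Schwarz bound into an integrable majorant;
  the absolute values make it meaningful for negative \<open>R\<close>, where \<open>C00 R\<close> contains only \<open>0\<close>.
\<close>

lemma pairing_norm_le:
  assumes "\<phi> \<in> C00 R" "norm (u x) \<le> M"
  shows "norm (u x \<bullet> apply_bcontfun \<phi> x) \<le> indicator {-\<bar>R\<bar>..\<bar>R\<bar>} x * (M * norm \<phi>)"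
proof (cases "\<bar>x\<bar> > R")
  case True
  have "0 \<le> M" using assms(2) norm_ge_zero order_trans by blast
  then show ?thesis using C00_eq_0[OF assms(1) True] by simp
next
  case False
  have "\<bar>u x \<bullet> apply_bcontfun \<phi> x\<bar> \<le> norm (u x) * norm (apply_bcontfun \<phi> x)"
    by (rule Cauchy_Schwarz_ineq2)
  also have "\<dots> \<le> M * norm \<phi>"
    using assms(2) norm_bounded[of \<phi> x] by (intro mult_mono) (auto intro: order_trans[OF norm_ge_zero])
  finally show ?thesis using False by (auto simp: indicator_def)
qed

lemma integrable_indicator_const: "integrable lebesgue (\<lambda>x. indicator {-\<bar>R\<bar>..\<bar>R::real\<bar>} x * (c::real))"
  by (intro integrable_mult_left) (auto intro!: integrable_real_indicator simp: emeasure_lborel_Icc_eq)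

lemma pairing_integrable:
  fixes u :: "real \<Rightarrow> real^'n::finite"
  assumes "\<phi> \<in> C00 R" "u \<in> borel_measurable lebesgue" "\<And>x. norm (u x) \<le> M"
  shows "integrable lebesgue (\<lambda>x. u x \<bullet> apply_bcontfun \<phi> x)"
proof (rule Bochner_Integration.integrable_bound[OF integrable_indicator_const[of R "M * norm \<phi>"]])
  have "apply_bcontfun \<phi> \<in> borel_measurable lebesgue"
    by (simp add: measurable_completion)
  then show "(\<lambda>x. u x \<bullet> apply_bcontfun \<phi> x) \<in> borel_measurable lebesgue"
    using assms(2) by (rule_tac borel_measurable_inner)
  show "AE x in lebesgue. norm (u x \<bullet> apply_bcontfun \<phi> x)
          \<le> norm (indicator {-\<bar>R\<bar>..\<bar>R\<bar>} x * (M * norm \<phi>))"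
    using order_trans[OF pairing_norm_le[of \<phi> R u _ M] abs_ge_self] assms(1,3)
    by (intro always_eventually allI) (simp del: abs_mult)
qed

lemma fun_pairing_bound:
  fixes u :: "real \<Rightarrow> real^'n::finite"
  assumes "\<phi> \<in> C00 R" "u \<in> borel_measurable lebesgue" "\<And>x. norm (u x) \<le> M"
  shows "\<bar>fun_pairing u \<phi>\<bar> \<le> 2 * \<bar>R\<bar> * M * norm \<phi>"
proof -
  have "norm (fun_pairing u \<phi>) \<le> (LINT x|lebesgue. indicator {-\<bar>R\<bar>..\<bar>R\<bar>} x * (M * norm \<phi>))"
    unfolding fun_pairing_def
    by (rule Bochner_Integration.integral_norm_bound_integral[OF pairing_integrable[OF assms] integrable_indicator_const])
       (rule pairing_norm_le[OF assms(1,3)])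
  also have "\<dots> = 2 * \<bar>R\<bar> * M * norm \<phi>"
    by (simp add: mult_ac)
  finally show ?thesis by simp
qed

lemma fun_pairing_linear:
  fixes u :: "real \<Rightarrow> real^'n::finite"
  assumes "\<phi> \<in> C00 R" "\<psi> \<in> C00 R" "u \<in> borel_measurable lebesgue" "\<And>x. norm (u x) \<le> M"
  shows "fun_pairing u (c *\<^sub>R \<phi> + d *\<^sub>R \<psi>) = c * fun_pairing u \<phi> + d * fun_pairing u \<psi>"
  using pairing_integrable[OF assms(1,3,4)] pairing_integrable[OF assms(2,3,4)]
  by (simp add: fun_pairing_def inner_add_right)

lemma fun_pairing_cong_AE:
  fixes u v :: "real \<Rightarrow> real^'n::finite"
  assumes "AE x in lebesgue. u x = v x" "v \<in> borel_measurable lebesgue"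
  shows "fun_pairing u \<phi> = fun_pairing v \<phi>"
proof -
  have u: "u \<in> borel_measurable lebesgue"
    by (rule borel_measurable_AE[OF assms(2)]) (use assms(1) in \<open>auto simp: eq_commute\<close>)
  have m: "apply_bcontfun \<phi> \<in> borel_measurable lebesgue"
    by (simp add: measurable_completion)
  show ?thesis unfolding fun_pairing_def
    using assms(1) by (intro integral_cong_AE borel_measurable_inner u m assms(2)) auto
qed

text \<open>
  The primitive that vanishes to the left of the support. Starting the integral at \<open>- R - 1\<close> instead of
  \<open>- R\<close> keeps the base point away from the points \<open>y \<ge> - R\<close> at which the two-sided derivative is taken
  from the integral; for \<open>y < - R\<close> the primitive is locally constant.
\<close>

lemma C00_primitive:
  fixes \<phi> :: "real \<Rightarrow>\<^sub>C (real^'n::finite)"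
  assumes "\<phi> \<in> C00 R"
  obtains \<Phi> where "\<And>y. (\<Phi> has_vector_derivative apply_bcontfun \<phi> y) (at y)" "\<And>y. y < - R \<Longrightarrow> \<Phi> y = 0"
proof
  define \<Phi> where "\<Phi> = (\<lambda>y. integral {- R - 1..y} (apply_bcontfun \<phi>))"
  show z: "\<Phi> y = 0" if "y < - R" for y
    unfolding \<Phi>_def using that C00_eq_0[OF assms]
    by (intro integral_unique has_integral_is_0) (auto simp: abs_if)
  show "(\<Phi> has_vector_derivative apply_bcontfun \<phi> y) (at y)" for y
  proof (cases "y < - R")
    case True
    have "((\<lambda>_. 0) has_vector_derivative apply_bcontfun \<phi> y) (at y)"
      using True C00_eq_0[OF assms, of y] by (auto simp: abs_if)
    then show ?thesis
      by (rule has_vector_derivative_transform_within_open[of _ _ _ "{..<-R}"]) (use True z in auto)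
  next
    case False
    then have "(\<Phi> has_vector_derivative apply_bcontfun \<phi> y) (at y within {- R - 1..y + 1})"
      unfolding \<Phi>_def by (intro integral_has_vector_derivative) auto
    moreover have "at y within {- R - 1..y + 1} = at y"
      using False by (intro at_within_interior) auto
    ultimately show ?thesis by simp
  qed
qed

text \<open>
  The fundamental theorem of calculus on \<open>[p, M]\<close> with \<open>M = max p R\<close>, outside which the integrand vanishes;
  the primitive is constant to the right of \<open>R\<close>, so \<open>\<Phi> M = \<Phi> R\<close>.
\<close>

lemma heaviside_pairing:
  fixes \<phi> :: "real \<Rightarrow>\<^sub>C (real^'n::finite)"
  assumes "\<phi> \<in> C00 R" and der: "\<And>y. (\<Phi> has_vector_derivative apply_bcontfun \<phi> y) (at y)"
  shows "(LINT x|lebesgue. (heaviside (x - p) *\<^sub>R a) \<bullet> apply_bcontfun \<phi> x) = a \<bullet> (\<Phi> R - \<Phi> p)"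
proof -
  define M where "M = max p R"
  have F: "(apply_bcontfun \<phi> has_integral (\<Phi> d - \<Phi> c)) {c..d}" if "c \<le> d" for c d
    using that by (intro fundamental_theorem_of_calculus) (auto intro: has_vector_derivative_at_within[OF der])
  have "\<Phi> M = \<Phi> R"
  proof -
    have "((\<lambda>x. 0) has_integral (\<Phi> M - \<Phi> R)) {R..M}"
      using C00_eq_0[OF assms(1)]
      by (intro has_integral_spike_finite[OF _ _ F, of "{R}"]) (auto simp: M_def)
    then show ?thesis by (simp add: has_integral_iff)
  qed
  moreover have "((\<lambda>x. (heaviside (x - p) *\<^sub>R a) \<bullet> apply_bcontfun \<phi> x) has_integral
      a \<bullet> (\<Phi> M - \<Phi> p)) UNIV"
  proof (rule has_integral_on_superset)
    have "((\<lambda>x. a \<bullet> apply_bcontfun \<phi> x) has_integral a \<bullet> (\<Phi> M - \<Phi> p)) {p..M}"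
      using has_integral_linear[OF F bounded_linear_inner_right[of a], of p M] by (simp add: M_def o_def)
    then show "((\<lambda>x. (heaviside (x - p) *\<^sub>R a) \<bullet> apply_bcontfun \<phi> x) has_integral
        a \<bullet> (\<Phi> M - \<Phi> p)) {p..M}"
      by (rule has_integral_spike_finite[of "{p}", rotated 2]) (auto simp: heaviside_def)
    show "(heaviside (x - p) *\<^sub>R a) \<bullet> apply_bcontfun \<phi> x = 0" if "x \<notin> {p..M}" for x
      using that C00_eq_0[OF assms(1), of x] by (auto simp: heaviside_def M_def)
  qed auto
  moreover have "integrable lebesgue (\<lambda>x. (heaviside (x - p) *\<^sub>R a) \<bullet> apply_bcontfun \<phi> x)"
    by (intro pairing_integrable[OF assms(1), where M="norm a"])
       (auto intro!: measurable_completion simp: heaviside_bounds mult_left_le_one_le)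
  ultimately show ?thesis
    using has_integral_integral_lebesgue has_integral_unique by metis
qed

lemma fun_pairing_step_fun:
  fixes \<phi> :: "real \<Rightarrow>\<^sub>C (real^'n::finite)"
  assumes "\<phi> \<in> C00 R" and der: "\<And>y. (\<Phi> has_vector_derivative apply_bcontfun \<phi> y) (at y)"
    and zero: "\<And>y. y < - R \<Longrightarrow> \<Phi> y = 0"
  shows "fun_pairing (step_fun b n p a) \<phi> = b \<bullet> \<Phi> R + (\<Sum>k<n. a k \<bullet> (\<Phi> R - \<Phi> (p k)))"
proof -
  \<comment> \<open>On the support of \<open>\<phi>\<close> the constant \<open>b\<close> is a jump located at a point \<open>q\<close> to its left.\<close>
  define q where "q = - R - 1"
  have i: "integrable lebesgue (\<lambda>x. (heaviside (x - r) *\<^sub>R c) \<bullet> apply_bcontfun \<phi> x)" for r c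
    by (intro pairing_integrable[OF assms(1), where M="norm c"])
       (auto intro!: measurable_completion simp: heaviside_bounds mult_left_le_one_le)
  have "fun_pairing (step_fun b n p a) \<phi> =
      (LINT x|lebesgue. (heaviside (x - q) *\<^sub>R b) \<bullet> apply_bcontfun \<phi> x +
         (\<Sum>k<n. (heaviside (x - p k) *\<^sub>R a k) \<bullet> apply_bcontfun \<phi> x))"
    unfolding fun_pairing_def step_fun_def inner_add_left inner_sum_left
  proof (intro Bochner_Integration.integral_cong refl arg_cong2[where f="(+)"])
    show "b \<bullet> apply_bcontfun \<phi> x = (heaviside (x - q) *\<^sub>R b) \<bullet> apply_bcontfun \<phi> x" for x
      using C00_eq_0[OF assms(1), of x] by (auto simp: heaviside_def q_def)
  qed
  also have "\<dots> = b \<bullet> (\<Phi> R - \<Phi> q) + (\<Sum>k<n. a k \<bullet> (\<Phi> R - \<Phi> (p k)))"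
    by (subst Bochner_Integration.integral_add Bochner_Integration.integral_sum; (intro Bochner_Integration.integrable_sum i)?)+
       (simp only: heaviside_pairing[OF assms(1) der])
  finally show ?thesis by (simp add: zero q_def)
qed

text \<open>
  The positions enter the pairing only through the \<open>C\<^sup>1\<close> function \<open>\<Phi>\<close>. This is how regularity of the
  front paths in time becomes regularity of the pairing in time, although the step function itself is
  discontinuous.
\<close>

lemma step_fun_pairing_formula:
  fixes \<phi> :: "real \<Rightarrow>\<^sub>C (real^'n::finite)"
  assumes "\<phi> \<in> C00 R"
  obtains \<Phi> where "\<And>y. (\<Phi> has_vector_derivative apply_bcontfun \<phi> y) (at y)"
    "\<And>b n p a. fun_pairing (step_fun b n p a) \<phi> = b \<bullet> \<Phi> R + (\<Sum>k<n. a k \<bullet> (\<Phi> R - \<Phi> (p k)))"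
proof -
  obtain \<Phi> where \<Phi>: "\<And>y. (\<Phi> has_vector_derivative apply_bcontfun \<phi> y) (at y)" "\<And>y. y < - R \<Longrightarrow> \<Phi> y = 0"
    using C00_primitive[OF assms] by blast
  show thesis
    by (rule that[OF \<Phi>(1)], rule fun_pairing_step_fun[OF assms \<Phi>])
qed

text \<open>
  The sum of the Dirac masses \<open>a k\<close> at \<open>p k\<close>. It serves as the space derivative of a step function and,
  with the jumps multiplied by the negative speeds, as its time derivative.
\<close>

definition jump_measure :: "nat \<Rightarrow> (nat \<Rightarrow> real) \<Rightarrow> (nat \<Rightarrow> real^'n::finite) \<Rightarrow> (real \<Rightarrow>\<^sub>C (real^'n)) \<Rightarrow> real" where
  "jump_measure n p a \<psi> = (\<Sum>k<n. a k \<bullet> apply_bcontfun \<psi> (p k))"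

lemma jump_measure_linear: "jump_measure n p a (c *\<^sub>R \<phi> + d *\<^sub>R \<psi>) = c * jump_measure n p a \<phi> + d * jump_measure n p a \<psi>"
  by (simp add: jump_measure_def inner_add_right sum.distrib sum_distrib_left)

lemma jump_measure_bound: "\<bar>jump_measure n p a \<psi>\<bar> \<le> (\<Sum>k<n. norm (a k)) * norm \<psi>"
proof -
  have "norm (jump_measure n p a \<psi>) \<le> (\<Sum>k<n. norm (a k) * norm \<psi>)"
    unfolding jump_measure_def
  proof (rule sum_norm_le)
    show "norm (a k \<bullet> apply_bcontfun \<psi> (p k)) \<le> norm (a k) * norm \<psi>" for k
      using Cauchy_Schwarz_ineq2[of "a k" "apply_bcontfun \<psi> (p k)"]
        mult_left_mono[OF norm_bounded[of \<psi> "p k"] norm_ge_zero[of "a k"]] by simp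
  qed
  then show ?thesis by (simp add: sum_distrib_right)
qed

lemma jump_measure_M_loc: "jump_measure n p a \<in> M_loc"
  unfolding local_dual_def using jump_measure_linear[of n p a] jump_measure_bound[of n p a] by blast

text \<open>
  Here \<open>\<psi>\<close> itself is the primitive of \<open>\<psi>'\<close> in the pairing formula, and it vanishes at the right end
  point \<open>r\<close>, which is chosen strictly outside the support.
\<close>

lemma derivative_measure_step_fun: 
  assumes "AE x in lebesgue. u x = step_fun b n p a x"
  shows "derivative_measure u (jump_measure n p a)"
  unfolding derivative_measure_def
proof (intro conjI allI ballI impI jump_measure_M_loc)
  fix R and \<psi> \<psi>' :: "real \<Rightarrow>\<^sub>C (real^'a)"
  assume \<psi>: "\<psi> \<in> C00 R" "\<psi>' \<in> C00 R"
    and der: "\<forall>x. (apply_bcontfun \<psi> has_vector_derivative apply_bcontfun \<psi>' x) (at x)"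
  define r where "r = \<bar>R\<bar> + 1"
  have r: "\<psi>' \<in> C00 r" "apply_bcontfun \<psi> r = 0" "\<And>y. y < - r \<Longrightarrow> apply_bcontfun \<psi> y = 0"
    using \<psi> by (auto simp: C00_def r_def)
  have "fun_pairing u \<psi>' = fun_pairing (step_fun b n p a) \<psi>'"
    by (rule fun_pairing_cong_AE[OF assms]) (simp add: measurable_completion)
  also have "\<dots> = - jump_measure n p a \<psi>"
    using fun_pairing_step_fun[OF r(1) der[rule_format] r(3)] r(2)
    by (simp add: jump_measure_def sum_negf)
  finally show "jump_measure n p a \<psi> = - fun_pairing u \<psi>'" by simp
qed

lemma step_fun_BV_loc:
  assumes "AE x in lebesgue. u x = step_fun b n p a x"
  shows "u \<in> BV_loc"
proof -
  have "step_fun b n p a absolutely_integrable_on {c..d}" for c d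
  proof -
    have "finite_measure (lebesgue_on {c..d})" by (simp add: finite_measure_lebesgue_on)
    then have "integrable (lebesgue_on {c..d}) (step_fun b n p a)"
      by (rule finite_measure.integrable_const_bound[where B="norm b + (\<Sum>k<n. norm (a k))"])
         (auto simp: norm_step_fun_le measurable_completion measurable_restrict_space1)
    then show ?thesis 
      by (simp add: set_integrable_def integrable_restrict_space)
  qed
  moreover obtain N where "negligible N" "\<And>x. x \<notin> N \<Longrightarrow> u x = step_fun b n p a x"
    using assms by (force elim!: AE_E3 simp: negligible_iff_null_sets)
  ultimately have "u absolutely_integrable_on {c..d}" for c d
    by (rule absolutely_integrable_spike[of _ _ N]) auto
  then show ?thesis using derivative_measure_step_fun[OF assms] by (auto simp: BV_loc_def)
qed

section \<open>Step functions with moving fronts\<close>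

definition time_slot :: "(nat \<Rightarrow> real) \<Rightarrow> real \<Rightarrow> nat" where
  "time_slot tt t = (THE j. tt j \<le> t \<and> t < tt (Suc j))"

lemma test_fun_derivatives:
  assumes "\<eta> \<in> test_fun \<tau>"
  shows "(\<eta> has_vector_derivative deriv \<eta> t) (at t)" "continuous_on UNIV \<eta>" "continuous_on UNIV (deriv \<eta>)"
    "\<eta> 0 = 0" "\<eta> \<tau> = 0" "\<exists>B. \<forall>t\<in>{0<..<\<tau>}. \<bar>\<eta> t\<bar> \<le> B \<and> \<bar>deriv \<eta> t\<bar> \<le> B"
proof -
  have d: "(deriv ^^ n) \<eta> field_differentiable (at x)" for n x
    using assms by (auto simp: test_fun_def)
  show "(\<eta> has_vector_derivative deriv \<eta> t) (at t)"
    using d[of 0 t] by (simp add: field_differentiable_derivI has_real_derivative_iff_has_vector_derivative[symmetric])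
  show c: "continuous_on UNIV \<eta>" "continuous_on UNIV (deriv \<eta>)"
    using d[of 0] d[of 1]
    by (auto intro!: continuous_at_imp_continuous_on field_differentiable_imp_continuous_at)
  show "\<eta> 0 = 0" "\<eta> \<tau> = 0"
    using assms by (auto simp: test_fun_def)
  have "compact (\<eta> ` {0..\<tau>} \<union> deriv \<eta> ` {0..\<tau>})"
    by (intro compact_Un compact_continuous_image continuous_on_subset[OF c(1)] continuous_on_subset[OF c(2)]) auto
  then obtain B where "\<forall>y\<in>\<eta> ` {0..\<tau>} \<union> deriv \<eta> ` {0..\<tau>}. norm y \<le> B"
    using compact_imp_bounded bounded_iff by metis
  then show "\<exists>B. \<forall>t\<in>{0<..<\<tau>}. \<bar>\<eta> t\<bar> \<le> B \<and> \<bar>deriv \<eta> t\<bar> \<le> B"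
    by (intro exI[of _ B]) auto
qed

text \<open>
  The slots \<open>[tt j, tt (j + 1))\<close> may be empty, since simultaneous interactions are processed one at a
  time; slot \<open>m\<close> is the last one considered.
\<close>

locale time_slots =
  fixes tt :: "nat \<Rightarrow> real" and m :: nat
  assumes tt_0: "tt 0 = 0" and tt_Suc: "\<And>j. tt j \<le> tt (Suc j)"
begin

lemma tt_mono: "i \<le> j \<Longrightarrow> tt i \<le> tt j"
  using tt_Suc by (rule lift_Suc_mono_le)

lemma time_slot_eq:
  assumes "t \<in> {tt j..<tt (Suc j)}"
  shows "time_slot tt t = j"
  unfolding time_slot_def
proof (rule the_equality)
  show "k = j" if "tt k \<le> t \<and> t < tt (Suc k)" for k
    using that assms tt_mono[of "Suc k" j] tt_mono[of "Suc j" k]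
    by (cases k j rule: linorder_cases) auto
qed (use assms in auto)

lemma time_slot:
  assumes "t \<in> {0<..<tt (Suc m)}"
  shows "time_slot tt t \<le> m" "t \<in> {tt (time_slot tt t)..<tt (Suc (time_slot tt t))}"
proof -
  define j where "j = (LEAST j. t < tt (Suc j))"
  have "t < tt (Suc j)" "j \<le> m"
    unfolding j_def using assms by (auto intro: LeastI Least_le)
  moreover have "tt j \<le> t"
  proof (cases j)
    case (Suc k)
    then have "\<not> t < tt (Suc k)" unfolding j_def using not_less_Least by (metis lessI)
    then show ?thesis using Suc by simp
  qed (use assms tt_0 in auto)
  ultimately have "t \<in> {tt j..<tt (Suc j)}" "j \<le> m" by auto
  then show "time_slot tt t \<le> m" "t \<in> {tt (time_slot tt t)..<tt (Suc (time_slot tt t))}"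
    using time_slot_eq by auto
qed

text \<open>
  Every time belongs to exactly one of finitely many slots, so the function is a finite sum of measurable
  functions cut off by indicators.
\<close>

lemma slotwise_measurable:
  fixes f :: "nat \<Rightarrow> real \<Rightarrow> real"
  assumes "\<And>j. f j \<in> borel_measurable borel"
  shows "(\<lambda>t. f (time_slot tt t) t) \<in> borel_measurable (lebesgue_on {0<..<tt (Suc m)})"
proof -
  have "(\<lambda>t. \<Sum>j\<le>m. indicator {tt j..<tt (Suc j)} t * f j t) \<in> borel_measurable borel"
    using assms by measurable
  then have "(\<lambda>t. \<Sum>j\<le>m. indicator {tt j..<tt (Suc j)} t * f j t)
      \<in> borel_measurable (lebesgue_on {0<..<tt (Suc m)})"
    by (simp add: measurable_completion measurable_restrict_space1)
  moreover have "(\<Sum>j\<le>m. indicator {tt j..<tt (Suc j)} t * f j t) = f (time_slot tt t) t"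
    if t: "t \<in> {0<..<tt (Suc m)}" for t
  proof -
    have "(\<Sum>j\<le>m. indicator {tt j..<tt (Suc j)} t * f j t)
        = (\<Sum>j\<le>m. if j = time_slot tt t then f j t else 0)"
    proof (rule sum.cong)
      show "indicator {tt j..<tt (Suc j)} t * f j t = (if j = time_slot tt t then f j t else 0)" for j
      proof (cases "t \<in> {tt j..<tt (Suc j)}")
        case True
        then show ?thesis by (simp only: time_slot_eq[OF True]) simp
      next
        case False
        then have "j \<noteq> time_slot tt t" using time_slot(2)[OF t] by blast
        then show ?thesis using False by simp
      qed
    qed simp
    then show ?thesis using time_slot[OF t] by simp
  qed
  ultimately show ?thesis
    by (rule measurable_cong[THEN iffD1, rotated]) simp
qed

text \<open>
  Bounds that are uniform in time within each slot become one bound, because only finitely many slots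
  occur; the sum of the slot constants replaces their maximum.
\<close>

lemma Linf_star_slotwise:
  assumes l: "\<And>t. t \<in> {0<..<tt (Suc m)} \<Longrightarrow> l t = f (time_slot tt t) t"
    and lin: "\<And>j t R x y c d. x \<in> X R \<Longrightarrow> y \<in> X R \<Longrightarrow> f j t (c *\<^sub>R x + d *\<^sub>R y) = c * f j t x + d * f j t y"
    and meas: "\<And>j R x. x \<in> X R \<Longrightarrow> (\<lambda>t. f j t x) \<in> borel_measurable borel"
    and bound: "\<And>j R. \<exists>C. \<forall>t. \<forall>x\<in>X R. \<bar>f j t x\<bar> \<le> C * norm x"
  shows "l \<in> Linf_star (tt (Suc m)) X"
proof -
  have ld: "f j t \<in> local_dual X" for j t
  proof -
    have "\<exists>C. \<forall>x\<in>X R. \<bar>f j t x\<bar> \<le> C * norm x" for R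
      using bound[of R j] by blast
    then show ?thesis
      unfolding local_dual_def by (simp add: lin)
  qed
  have b: "\<exists>C. \<forall>t\<in>{0<..<tt (Suc m)}. \<forall>x\<in>X R. \<bar>l t x\<bar> \<le> C * norm x" for R
  proof -
    obtain C where C: "\<And>j t x. x \<in> X R \<Longrightarrow> \<bar>f j t x\<bar> \<le> C j * norm x"
      using bound[of R] by metis
    have "\<bar>l t x\<bar> \<le> (\<Sum>j\<le>m. \<bar>C j\<bar>) * norm x" if t: "t \<in> {0<..<tt (Suc m)}" and x: "x \<in> X R" for t x
    proof -
      have "C (time_slot tt t) \<le> (\<Sum>j\<le>m. \<bar>C j\<bar>)"
        using time_slot(1)[OF t] member_le_sum[of "time_slot tt t" "{..m}" "\<lambda>j. \<bar>C j\<bar>"] by simp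
      then show ?thesis
        unfolding l[OF t] by (intro order_trans[OF C[OF x]] mult_right_mono) auto
    qed
    then show ?thesis by blast
  qed
  have "(\<lambda>t. l t x) \<in> borel_measurable (lebesgue_on {0<..<tt (Suc m)})" if "x \<in> X R" for x R
    using slotwise_measurable[of "\<lambda>j t. f j t x"] meas[OF that] l
    by (subst measurable_cong[where g="\<lambda>t. f (time_slot tt t) t x"]) auto
  then show ?thesis
    unfolding Linf_star_def
  proof (intro CollectI conjI ballI allI)
    show "\<exists>C. AE t in lebesgue_on {0<..<tt (Suc m)}. \<forall>x\<in>X R. \<bar>l t x\<bar> \<le> C * norm x" for R
    proof -
      obtain C where "\<forall>t\<in>{0<..<tt (Suc m)}. \<forall>x\<in>X R. \<bar>l t x\<bar> \<le> C * norm x"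
        using b[of R] by blast
      then show ?thesis by (intro exI[of _ C] AE_I2) auto
    qed
  qed (use l ld in auto)
qed

end

text \<open>
  A function \<open>u\<close> of time and space which on the \<open>j\<close>-th slot has \<open>n j\<close> fronts with jumps \<open>a j k\<close> at
  \<open>p j k t\<close>. Each path may have a kink, because the speed of a multi-rarefaction changes once. The
  assumption \<open>matching\<close> says that the spatial profile does not change when one slot is replaced by the
  next; without it the time derivative would contain a mass concentrated at that time.
\<close>

locale front_evolution = time_slots tt m for tt m +
  fixes n :: "nat \<Rightarrow> nat" and b :: "nat \<Rightarrow> real^'n::finite" and a :: "nat \<Rightarrow> nat \<Rightarrow> real^'n"
    and p v :: "nat \<Rightarrow> nat \<Rightarrow> real \<Rightarrow> real" and kink :: "nat \<Rightarrow> nat \<Rightarrow> real" and u :: "real \<Rightarrow> real \<Rightarrow> real^'n"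
  assumes path_continuous: "\<And>j k. continuous_on UNIV (p j k)"
    and path_deriv: "\<And>j k t. t \<noteq> kink j k \<Longrightarrow> (p j k has_vector_derivative v j k t) (at t)"
    and speed_measurable: "\<And>j k. v j k \<in> borel_measurable borel"
    and speed_bounded: "\<And>j k. \<exists>C. \<forall>t. \<bar>v j k t\<bar> \<le> C"
    and matching: "\<And>j. j < m \<Longrightarrow>
      step_fun (b j) (n j) (\<lambda>k. p j k (tt (Suc j))) (a j) =
      step_fun (b (Suc j)) (n (Suc j)) (\<lambda>k. p (Suc j) k (tt (Suc j))) (a (Suc j))"
    and u_eq_step: "\<And>j t. j \<le> m \<Longrightarrow> t \<in> {tt j..<tt (Suc j)} \<Longrightarrow>
      AE x in lebesgue. u t x = step_fun (b j) (n j) (\<lambda>k. p j k t) (a j) x"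
begin

abbreviation profile :: "nat \<Rightarrow> real \<Rightarrow> real \<Rightarrow> real^'n" where
  "profile j t \<equiv> step_fun (b j) (n j) (\<lambda>k. p j k t) (a j)"

abbreviation space_deriv :: "nat \<Rightarrow> real \<Rightarrow> (real \<Rightarrow>\<^sub>C (real^'n)) \<Rightarrow> real" where
  "space_deriv j t \<equiv> jump_measure (n j) (\<lambda>k. p j k t) (a j)"

abbreviation time_deriv :: "nat \<Rightarrow> real \<Rightarrow> (real \<Rightarrow>\<^sub>C (real^'n)) \<Rightarrow> real" where
  "time_deriv j t \<equiv> jump_measure (n j) (\<lambda>k. p j k t) (\<lambda>k. - (v j k t *\<^sub>R a j k))"

lemma u_pairing:
  "t \<in> {0<..<tt (Suc m)} \<Longrightarrow> fun_pairing (u t) \<phi> = fun_pairing (profile (time_slot tt t) t) \<phi>"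
  using fun_pairing_cong_AE[OF u_eq_step[OF time_slot]] by (simp add: measurable_completion)

lemma path_measurable [measurable]: "p j k \<in> borel_measurable borel"
  by (intro borel_measurable_continuous_onI path_continuous)

lemma profile_pairing_continuous:
  assumes "\<phi> \<in> C00 R"
  shows "continuous_on UNIV (\<lambda>t. fun_pairing (profile j t) \<phi>)"
proof -
  obtain \<Phi> where \<Phi>: "\<And>y. (\<Phi> has_vector_derivative apply_bcontfun \<phi> y) (at y)"
    "\<And>b n p a. fun_pairing (step_fun b n p a) \<phi> = b \<bullet> \<Phi> R + (\<Sum>k<n. a k \<bullet> (\<Phi> R - \<Phi> (p k)))"
    using step_fun_pairing_formula[OF assms] by metis
  have "continuous_on UNIV \<Phi>"
    by (intro continuous_at_imp_continuous_on ballI has_vector_derivative_continuous[OF \<Phi>(1)])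
  then show ?thesis
    unfolding \<Phi>(2)
    by (intro continuous_intros continuous_on_compose2[OF _ path_continuous]) auto
qed

lemma profile_pairing_deriv:
  assumes "\<phi> \<in> C00 R" and "t \<notin> kink j ` {..<n j}"
  shows "((\<lambda>t. fun_pairing (profile j t) \<phi>) has_vector_derivative time_deriv j t \<phi>) (at t)"
proof -
  obtain \<Phi> where \<Phi>: "\<And>y. (\<Phi> has_vector_derivative apply_bcontfun \<phi> y) (at y)"
    "\<And>b n p a. fun_pairing (step_fun b n p a) \<phi> = b \<bullet> \<Phi> R + (\<Sum>k<n. a k \<bullet> (\<Phi> R - \<Phi> (p k)))"
    using step_fun_pairing_formula[OF assms(1)] by metis
  have d: "((\<lambda>t. a j k \<bullet> (\<Phi> R - \<Phi> (p j k t))) has_vector_derivative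
      (- (v j k t *\<^sub>R a j k)) \<bullet> apply_bcontfun \<phi> (p j k t)) (at t)" if "k < n j" for k
  proof -
    have "t \<noteq> kink j k" using assms(2) that by auto
    then have "(\<Phi> \<circ> p j k has_vector_derivative v j k t *\<^sub>R apply_bcontfun \<phi> (p j k t)) (at t)"
      by (intro vector_diff_chain_at path_deriv \<Phi>(1))
    then have "((\<lambda>t. \<Phi> R - \<Phi> (p j k t)) has_vector_derivative 0 - v j k t *\<^sub>R apply_bcontfun \<phi> (p j k t)) (at t)"
      by (intro has_vector_derivative_diff) (auto simp: o_def)
    from bounded_linear.has_vector_derivative[OF bounded_linear_inner_right this, of "a j k"]
    show ?thesis by simp
  qed
  have "((\<lambda>t. b j \<bullet> \<Phi> R + (\<Sum>k<n j. a j k \<bullet> (\<Phi> R - \<Phi> (p j k t)))) has_vector_derivative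
      0 + (\<Sum>k<n j. (- (v j k t *\<^sub>R a j k)) \<bullet> apply_bcontfun \<phi> (p j k t))) (at t)"
    by (intro has_vector_derivative_add has_vector_derivative_const has_vector_derivative_sum d) auto
  then show ?thesis
    unfolding \<Phi>(2) jump_measure_def by simp
qed

lemma space_deriv_measurable: "(\<lambda>t. space_deriv j t \<psi>) \<in> borel_measurable borel"
  unfolding jump_measure_def by measurable

lemma time_deriv_measurable: "(\<lambda>t. time_deriv j t \<psi>) \<in> borel_measurable borel"
  using speed_measurable unfolding jump_measure_def by measurable

lemma profile_measurable: "profile j t \<in> borel_measurable lebesgue"
  by (simp add: measurable_completion)

text \<open>
  The pairing with a pair \<open>(\<phi>, \<psi>)\<close> of the predual involves the values of \<open>u\<close> through \<open>\<phi>\<close> and its jump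
  measure through \<open>\<psi>\<close>; both parts are bounded in terms of the left state, the jumps and the support of
  the test functions, independently of the positions of the fronts.
\<close>

lemma u_Linf_BV: "u \<in> Linf_BV (tt (Suc m))"
proof -
  let ?\<mu> = "\<lambda>t. space_deriv (time_slot tt t) t"
  have "(\<lambda>t. BV_pairing (u t) (?\<mu> t)) \<in> Linf_star (tt (Suc m)) Cm1"
  proof (rule Linf_star_slotwise[where f="\<lambda>j t. BV_pairing (profile j t) (space_deriv j t)"])
    show "BV_pairing (u t) (?\<mu> t) = BV_pairing (profile (time_slot tt t) t) (?\<mu> t)"
      if "t \<in> {0<..<tt (Suc m)}" for t
      using u_pairing[OF that] by (auto simp: BV_pairing_def fun_eq_iff)
    show "BV_pairing (profile j t) (space_deriv j t) (c *\<^sub>R x + d *\<^sub>R y) =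
        c * BV_pairing (profile j t) (space_deriv j t) x + d * BV_pairing (profile j t) (space_deriv j t) y"
      if "x \<in> Cm1 R" "y \<in> Cm1 R" for x y R c d j t
    proof -
      have "fst x \<in> C00 R" "fst y \<in> C00 R"
        using that by (auto simp: Cm1_def)
      from fun_pairing_linear[OF this profile_measurable norm_step_fun_le] show ?thesis
        by (simp add: BV_pairing_def split_beta jump_measure_linear algebra_simps)
    qed
    show "(\<lambda>t. BV_pairing (profile j t) (space_deriv j t) x) \<in> borel_measurable borel"
      if "x \<in> Cm1 R" for x R j
    proof -
      have "(\<lambda>t. fun_pairing (profile j t) (fst x)) \<in> borel_measurable borel"
        using that by (intro borel_measurable_continuous_onI profile_pairing_continuous[of _ R]) (auto simp: Cm1_def)
      then show ?thesis
        using space_deriv_measurable by (simp add: BV_pairing_def split_beta)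
    qed
    fix j R
    let ?A = "\<Sum>k<n j. norm (a j k)"
    let ?M = "norm (b j) + ?A"
    have "\<bar>BV_pairing (profile j t) (space_deriv j t) (\<phi>, \<psi>)\<bar> \<le> (2 * \<bar>R\<bar> * ?M + ?A) * norm (\<phi>, \<psi>)"
      if "\<phi> \<in> C00 R" for t \<phi> \<psi>
    proof -
      have "\<bar>fun_pairing (profile j t) \<phi>\<bar> \<le> 2 * \<bar>R\<bar> * ?M * norm (\<phi>, \<psi>)"
        by (rule order_trans[OF fun_pairing_bound[OF that profile_measurable norm_step_fun_le]])
           (use norm_fst_le[of \<phi> \<psi>] in \<open>auto intro!: mult_left_mono mult_nonneg_nonneg add_nonneg_nonneg sum_nonneg\<close>)
      moreover have "\<bar>space_deriv j t \<psi>\<bar> \<le> ?A * norm (\<phi>, \<psi>)"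
        by (rule order_trans[OF jump_measure_bound])
           (use norm_snd_le[of \<psi> \<phi>] in \<open>auto intro!: mult_left_mono sum_nonneg\<close>)
      ultimately show ?thesis
        by (simp add: BV_pairing_def distrib_right abs_le_iff)
    qed
    then show "\<exists>C. \<forall>t. \<forall>x\<in>Cm1 R. \<bar>BV_pairing (profile j t) (space_deriv j t) x\<bar> \<le> C * norm x"
      by (intro exI[of _ "2 * \<bar>R\<bar> * ?M + ?A"]) (auto simp: Cm1_def)
  qed
  moreover have "u t \<in> BV_loc \<and> derivative_measure (u t) (?\<mu> t)" if "t \<in> {0<..<tt (Suc m)}" for t
    using step_fun_BV_loc[OF u_eq_step[OF time_slot[OF that]]]
      derivative_measure_step_fun[OF u_eq_step[OF time_slot[OF that]]] by blast
  ultimately show ?thesis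
    unfolding Linf_BV_def by (intro CollectI conjI exI[of _ ?\<mu>] ballI) auto
qed

lemma time_deriv_bound: "\<exists>C. \<forall>t. \<forall>\<phi>. \<bar>time_deriv j t \<phi>\<bar> \<le> C * norm \<phi>"
proof -
  obtain C where C: "\<And>k t. \<bar>v j k t\<bar> \<le> C k"
    using speed_bounded[of j] by metis
  have "\<bar>time_deriv j t \<phi>\<bar> \<le> (\<Sum>k<n j. C k * norm (a j k)) * norm \<phi>" for t \<phi>
    by (rule order_trans[OF jump_measure_bound])
       (auto intro!: mult_right_mono sum_mono C)
  then show ?thesis by blast
qed

lemma u_time_deriv: "(\<lambda>t. time_deriv (time_slot tt t) t) \<in> Linf_star (tt (Suc m)) C00"
proof (rule Linf_star_slotwise[where f=time_deriv])
  show "\<exists>C. \<forall>t. \<forall>x\<in>C00 R. \<bar>time_deriv j t x\<bar> \<le> C * norm x" for j R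
    using time_deriv_bound by blast
qed (simp_all add: jump_measure_linear time_deriv_measurable)

text \<open>
  On each slot \<open>\<eta> \<langle>u, \<phi>\<rangle>\<close> is a primitive of the integrand up to finitely many kinks. The boundary terms at
  the interior slot ends cancel by \<open>matching\<close>, and those at \<open>0\<close> and at the final time vanish with \<open>\<eta>\<close>.
\<close>

lemma integration_by_parts:
  assumes \<phi>: "\<phi> \<in> C00 R" and \<eta>: "\<eta> \<in> test_fun (tt (Suc m))"
  shows "((\<lambda>t. deriv \<eta> t * fun_pairing (profile (time_slot tt t) t) \<phi> + \<eta> t * time_deriv (time_slot tt t) t \<phi>)
    has_integral 0) {0..tt (Suc m)}"
proof -
  note td = test_fun_derivatives[OF \<eta>]
  let ?G = "\<lambda>j t. fun_pairing (profile j t) \<phi>"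
  let ?h = "\<lambda>t. deriv \<eta> t * ?G (time_slot tt t) t + \<eta> t * time_deriv (time_slot tt t) t \<phi>"
  have slot: "(?h has_integral \<eta> (tt (Suc j)) * ?G j (tt (Suc j)) - \<eta> (tt j) * ?G j (tt j)) {tt j..tt (Suc j)}" for j
  proof -
    have "((\<lambda>t. \<eta> t * time_deriv j t \<phi> + deriv \<eta> t * ?G j t) has_integral
        \<eta> (tt (Suc j)) * ?G j (tt (Suc j)) - \<eta> (tt j) * ?G j (tt j)) {tt j..tt (Suc j)}"
    proof (rule fundamental_theorem_of_calculus_strong[of "kink j ` {..<n j}"])
      show "continuous_on {tt j..tt (Suc j)} (\<lambda>t. \<eta> t * ?G j t)"
        by (intro continuous_on_mult continuous_on_subset[OF td(2)]
            continuous_on_subset[OF profile_pairing_continuous[OF \<phi>]]) auto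
    qed (auto intro!: has_vector_derivative_mult td profile_pairing_deriv[OF \<phi>] tt_Suc)
    \<comment> \<open>The right end point already belongs to a later slot, but it is a null set.\<close>
    then show ?thesis
      by (rule has_integral_spike_finite[of "{tt (Suc j)}", rotated 2]) (auto simp: time_slot_eq[of _ j])
  qed
  have "j \<le> m \<Longrightarrow> (?h has_integral \<eta> (tt (Suc j)) * ?G j (tt (Suc j))) {0..tt (Suc j)}" for j
  proof (induction j)
    case 0
    then show ?case using slot[of 0] td(4) by (simp add: tt_0)
  next
    case (Suc j)
    have "?G j (tt (Suc j)) = ?G (Suc j) (tt (Suc j))"
      using matching[of j] Suc.prems by simp
    then show ?case
      using has_integral_combine[OF _ _ Suc.IH slot[of "Suc j"]] Suc.prems tt_Suc[of "Suc j"] tt_mono[of 0 "Suc j"] tt_0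
      by simp
  qed
  from this[of m] show ?thesis using td(5) by simp
qed

text \<open>
  The identity of \<open>integration_by_parts\<close> concerns the gauge integral of a sum, whereas the weak derivative
  is defined by two separate Lebesgue integrals. Both terms are bounded and measurable on a set of finite
  measure, which makes them integrable and lets the integral be split.
\<close>

lemma u_W1inf: "u \<in> W1inf (tt (Suc m))"
proof -
  let ?\<tau> = "tt (Suc m)"
  let ?D = "\<lambda>t. time_deriv (time_slot tt t) t"
  have "(LINT t|lebesgue_on {0<..<?\<tau>}. deriv \<eta> t * fun_pairing (u t) \<phi>)
      = - (LINT t|lebesgue_on {0<..<?\<tau>}. \<eta> t * ?D t \<phi>)"
    if \<eta>: "\<eta> \<in> test_fun ?\<tau>" and \<phi>: "\<phi> \<in> C00 R" for \<eta> R \<phi>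
  proof -
    note td = test_fun_derivatives[OF \<eta>]
    let ?F = "\<lambda>t. fun_pairing (profile (time_slot tt t) t) \<phi>"
    interpret fm: finite_measure "lebesgue_on {0<..<?\<tau>}"
      by (rule finite_measure_lebesgue_on) simp
    obtain B where B: "\<And>t. t \<in> {0<..<?\<tau>} \<Longrightarrow> \<bar>\<eta> t\<bar> \<le> B \<and> \<bar>deriv \<eta> t\<bar> \<le> B"
      using td(6) by blast
    have m: "\<eta> \<in> borel_measurable borel" "deriv \<eta> \<in> borel_measurable borel"
      using td by (auto intro: borel_measurable_continuous_onI)
    have F: "(\<lambda>t. ?F t) \<in> borel_measurable (lebesgue_on {0<..<?\<tau>})"
      by (rule slotwise_measurable) (intro borel_measurable_continuous_onI profile_pairing_continuous[OF \<phi>])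
    have D: "(\<lambda>t. ?D t \<phi>) \<in> borel_measurable (lebesgue_on {0<..<?\<tau>})"
      by (rule slotwise_measurable) (rule time_deriv_measurable)
    have bounded_integrable: "integrable (lebesgue_on {0<..<?\<tau>}) (\<lambda>t. g t * f (time_slot tt t) t)"
      if g: "g \<in> borel_measurable borel" "\<And>t. t \<in> {0<..<?\<tau>} \<Longrightarrow> \<bar>g t\<bar> \<le> B"
        and f: "(\<lambda>t. f (time_slot tt t) t) \<in> borel_measurable (lebesgue_on {0<..<?\<tau>})"
        "\<And>j. \<exists>C. \<forall>t. \<bar>f j t\<bar> \<le> C" for g :: "real \<Rightarrow> real" and f :: "nat \<Rightarrow> real \<Rightarrow> real"
    proof -
      obtain C where C: "\<And>j t. \<bar>f j t\<bar> \<le> C j" using f(2) by metis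
      have "\<bar>g t * f (time_slot tt t) t\<bar> \<le> B * (\<Sum>j\<le>m. \<bar>C j\<bar>)" if t: "t \<in> {0<..<?\<tau>}" for t
      proof -
        have "C (time_slot tt t) \<le> (\<Sum>j\<le>m. \<bar>C j\<bar>)"
          using time_slot(1)[OF t] member_le_sum[of "time_slot tt t" "{..m}" "\<lambda>j. \<bar>C j\<bar>"] by simp
        then show ?thesis
          using g(2)[OF t] C[of "time_slot tt t" t] unfolding abs_mult
          by (intro mult_mono) (auto intro: sum_nonneg order_trans[OF abs_ge_zero])
      qed
      moreover have "(\<lambda>t. g t * f (time_slot tt t) t) \<in> borel_measurable (lebesgue_on {0<..<?\<tau>})"
        using g(1) f(1) by (intro borel_measurable_times) (simp_all add: measurable_completion measurable_restrict_space1)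
      ultimately show ?thesis
        by (intro fm.integrable_const_bound[where B="B * (\<Sum>j\<le>m. \<bar>C j\<bar>)"]) (auto intro!: AE_I2)
    qed
    have i1: "integrable (lebesgue_on {0<..<?\<tau>}) (\<lambda>t. deriv \<eta> t * ?F t)"
    proof (intro bounded_integrable[of "deriv \<eta>" "\<lambda>j t. fun_pairing (profile j t) \<phi>"] m F)
      show "\<exists>C. \<forall>t. \<bar>fun_pairing (profile j t) \<phi>\<bar> \<le> C" for j
        using fun_pairing_bound[OF \<phi> profile_measurable norm_step_fun_le] by blast
    qed (use B in auto)
    have i2: "integrable (lebesgue_on {0<..<?\<tau>}) (\<lambda>t. \<eta> t * ?D t \<phi>)"
    proof (intro bounded_integrable[of \<eta> "\<lambda>j t. time_deriv j t \<phi>"] m D)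
      show "\<exists>C. \<forall>t. \<bar>time_deriv j t \<phi>\<bar> \<le> C" for j
        using time_deriv_bound[of j] by metis
    qed (use B in auto)
    have "(LINT t|lebesgue_on {0<..<?\<tau>}. deriv \<eta> t * ?F t) + (LINT t|lebesgue_on {0<..<?\<tau>}. \<eta> t * ?D t \<phi>)
        = (LINT t|lebesgue_on {0<..<?\<tau>}. deriv \<eta> t * ?F t + \<eta> t * ?D t \<phi>)"
      using i1 i2 by simp
    also have "\<dots> = 0"
      by (rule has_integral_unique[OF has_integral_integral_lebesgue_on[OF Bochner_Integration.integrable_add[OF i1 i2]]])
         (use integration_by_parts[OF \<phi> \<eta>] in \<open>simp_all add: has_integral_Icc_iff_Ioo\<close>)
    finally have "(LINT t|lebesgue_on {0<..<?\<tau>}. deriv \<eta> t * ?F t) = - (LINT t|lebesgue_on {0<..<?\<tau>}. \<eta> t * ?D t \<phi>)"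
      by simp
    moreover have "(LINT t|lebesgue_on {0<..<?\<tau>}. deriv \<eta> t * fun_pairing (u t) \<phi>)
        = (LINT t|lebesgue_on {0<..<?\<tau>}. deriv \<eta> t * ?F t)"
      by (rule Bochner_Integration.integral_cong) (auto simp: u_pairing)
    ultimately show ?thesis by simp
  qed
  then show ?thesis
    unfolding W1inf_def by (intro CollectI conjI u_Linf_BV bexI[OF _ u_time_deriv]) auto
qed

end

section \<open>Motion of composite waves\<close>

definition front_speed :: "('n::finite) composite \<Rightarrow> real \<Rightarrow> real" where
  "front_speed c t = (if t < tsharp c then tspeed c else speed c)"

lemma pos_continuous: "continuous_on UNIV (pos c)"
  unfolding pos_def [abs_def] by (intro continuous_intros)

lemma pos_deriv:
  assumes "t \<noteq> tsharp c"
  shows "(pos c has_vector_derivative front_speed c t) (at t)"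
proof (cases "t < tsharp c")
  case True
  have "((\<lambda>t. xbirth c + tspeed c * (t - tbirth c)) has_vector_derivative front_speed c t) (at t)"
    using True by (auto simp: front_speed_def has_real_derivative_iff_has_vector_derivative[symmetric] intro!: derivative_eq_intros)
  then show ?thesis
    by (rule has_vector_derivative_transform_within_open[of _ _ _ "{..<tsharp c}"])
       (use True in \<open>auto simp: pos_def\<close>)
next
  case False
  have "((\<lambda>t. xbirth c + tspeed c * (tsharp c - tbirth c) + speed c * (t - tsharp c))
      has_vector_derivative front_speed c t) (at t)"
    using False by (auto simp: front_speed_def has_real_derivative_iff_has_vector_derivative[symmetric] intro!: derivative_eq_intros)
  then show ?thesis
    by (rule has_vector_derivative_transform_within_open[of _ _ _ "{tsharp c<..}"])
       (use False assms in \<open>auto simp: pos_def\<close>)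
qed

lemma front_speed_measurable: "front_speed c \<in> borel_measurable borel"
  unfolding front_speed_def [abs_def] by measurable

lemma front_speed_bounded: "\<exists>C. \<forall>t. \<bar>front_speed c t\<bar> \<le> C"
  by (intro exI[of _ "max \<bar>tspeed c\<bar> \<bar>speed c\<bar>"]) (auto simp: front_speed_def)

section \<open>Chains of waves\<close>

lemma wave_chain_append:
  "wave_chain u (xs @ ys) u' \<longleftrightarrow> (\<exists>v. wave_chain u xs v \<and> wave_chain v ys u')"
  by (induction xs arbitrary: u) auto

lemma wave_chain_end_in:
  "wave_chain u ws u' \<Longrightarrow> u \<in> X \<Longrightarrow> (\<And>w. w \<in> set ws \<Longrightarrow> rst w \<in> X) \<Longrightarrow> u' \<in> X"
  by (induction ws arbitrary: u) auto

lemma wave_chain_ends: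
  "wave_chain u ws u' \<Longrightarrow> ws \<noteq> [] \<Longrightarrow> lst (hd ws) = u \<and> rst (last ws) = u'"
  by (induction ws arbitrary: u) (auto split: if_splits)

text \<open>
  The jump of \<open>g\<close> across a composite wave is built from the jumps across its members because this is the
  form in which the approximation is defined; in a chain it telescopes to the outer states.
\<close>

definition jump :: "(real^'n \<Rightarrow> real^'n) \<Rightarrow> ('n::finite) composite \<Rightarrow> real^'n" where
  "jump g c = (\<Sum>w\<leftarrow>members c. g (rst w) - g (lst w))"

lemma wave_chain_sum_jumps:
  fixes g :: "real^'n::finite \<Rightarrow> real^'n"
  shows "wave_chain u ws u' \<Longrightarrow> (\<Sum>w\<leftarrow>ws. g (rst w) - g (lst w)) = g u' - g u"
  by (induction ws arbitrary: u) auto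

definition front_sum :: "(real^'n \<Rightarrow> real^'n) \<Rightarrow> ('n::finite) composite list \<Rightarrow> real \<Rightarrow> real \<Rightarrow> real^'n" where
  "front_sum g cs t x = (\<Sum>c\<leftarrow>cs. heaviside (x - pos c t) *\<^sub>R jump g c)"

lemma front_sum_simps [simp]:
  "front_sum g [] t x = 0"
  "front_sum g (c # cs) t x = heaviside (x - pos c t) *\<^sub>R jump g c + front_sum g cs t x"
  "front_sum g (cs @ ds) t x = front_sum g cs t x + front_sum g ds t x"
  by (simp_all add: front_sum_def)

lemma front_sum_eq_step_fun:
  "u0 + front_sum g cs t x = step_fun u0 (length cs) (\<lambda>k. pos (cs ! k) t) (\<lambda>k. jump g (cs ! k)) x"
  by (simp add: front_sum_def step_fun_def sum_list_sum_nth atLeast0LessThan)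

lemma approx_eq_front_sum: "approx \<Gamma> t x = ubase \<Gamma> + front_sum (\<lambda>u. u) (comps \<Gamma>) t x"
proof -
  have "(\<Sum>w\<leftarrow>ws. r *\<^sub>R (rst w - lst w)) = r *\<^sub>R (\<Sum>w\<leftarrow>ws. rst w - lst w)" for r and ws :: "'a wave list"
    by (induction ws) (simp_all add: scaleR_add_right)
  then show ?thesis by (simp add: approx_def front_sum_def jump_def)
qed

text \<open>
  At an interaction point only the outer states of the fronts meeting or leaving there are visible. The
  incoming and the outgoing waves share these outer states, so their contributions agree at every \<open>x\<close>.
\<close>

lemma front_sum_same_position:
  assumes "\<And>c. c \<in> set cs \<Longrightarrow> pos c t = y" "wave_chain u (concat (map members cs)) u'"
  shows "front_sum g cs t x = heaviside (x - y) *\<^sub>R (g u' - g u)"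
  using assms
proof (induction cs arbitrary: u)
  case (Cons c cs)
  then obtain v where v: "wave_chain u (members c) v" "wave_chain v (concat (map members cs)) u'"
    by (auto simp: wave_chain_append)
  have "front_sum g cs t x = heaviside (x - y) *\<^sub>R (g u' - g v)"
    using Cons.IH[OF _ v(2)] Cons.prems(1) by simp
  moreover have "jump g c = g v - g u"
    unfolding jump_def by (rule wave_chain_sum_jumps[OF v(1)])
  ultimately show ?case
    using Cons.prems(1)[of c] by (simp flip: scaleR_add_right)
qed simp

text \<open>
  In an ordered chain the fronts to the left of \<open>x\<close> form an initial segment, over which the jumps of any
  \<open>g\<close> telescope to \<open>g s - g u\<close>, where \<open>s\<close> is the last state reached before \<open>x\<close>. That \<open>s\<close> is the same for
  every \<open>g\<close> is essential: for the identity it is the value of the approximation itself.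
\<close>

lemma front_sum_sorted:
  assumes "wave_chain u (concat (map members cs)) u'" "sorted (map (\<lambda>c. pos c t) cs)"
    "\<And>c. c \<in> set cs \<Longrightarrow> pos c t \<noteq> x"
  shows "\<exists>s\<in>insert u (rst ` set (concat (map members cs))). \<forall>g. g u + front_sum g cs t x = g s"
  using assms
proof (induction cs arbitrary: u)
  case (Cons c cs)
  then obtain v where v: "wave_chain u (members c) v" "wave_chain v (concat (map members cs)) u'"
    by (auto simp: wave_chain_append)
  have j: "jump g c = g v - g u" for g
    unfolding jump_def by (rule wave_chain_sum_jumps[OF v(1)])
  show ?case
  proof (cases "x < pos c t")
    case True
    have "front_sum g cs t x = (\<Sum>c\<leftarrow>cs. 0)" for g
      unfolding front_sum_def
      by (intro arg_cong[where f=sum_list] map_cong refl)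
         (use True Cons.prems(2) in \<open>fastforce simp: heaviside_def\<close>)
    then show ?thesis using True by (intro bexI[of _ u]) (auto simp: heaviside_def)
  next
    case False
    then have h: "heaviside (x - pos c t) = 1"
      using Cons.prems(3)[of c] by (auto simp: heaviside_def)
    have "sorted (map (\<lambda>c. pos c t) cs)" "\<And>c. c \<in> set cs \<Longrightarrow> pos c t \<noteq> x"
      using Cons.prems(2,3) by auto
    from Cons.IH[OF v(2) this] obtain s where s: "s \<in> insert v (rst ` set (concat (map members cs)))"
      "\<And>g. g v + front_sum g cs t x = g s"
      by blast
    have "v \<in> insert u (rst ` set (members c))"
      using wave_chain_end_in[OF v(1), of "insert u (rst ` set (members c))"] by blast
    then have "s \<in> insert u (rst ` set (concat (map members (c # cs))))"
      using s(1) by auto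
    moreover have "g u + front_sum g (c # cs) t x = g s" for g
      using s(2)[of g] by (simp add: h j)
    ultimately show ?thesis by blast
  qed
qed simp

section \<open>The chain property along the scheme\<close>

text \<open>
  At strength \<open>0\<close> the wave relation reduces to the flow of \<open>r\<^sub>k\<close> at parameter \<open>0\<close>. The identification of
  \<open>E\<^sub>k\<close> with \<open>W\<^sub>k\<close> is only given on \<open>states S\<close>, which is why the proof of the chain property keeps track of
  the states.
\<close>

lemma gRP_null_wave:
  assumes "conservation_law S" "gRP S w uL uR z v" "k \<in> fams S" "v (k - 1) \<in> states S" "z k = 0"
  shows "v k = v (k - 1)"
proof -
  have "shock_or_wave S k (v (k - 1)) 0 u' \<longleftrightarrow> simple_wave S k (v (k - 1)) 0 u'" for u'
    using assms(1,3,4) unfolding conservation_law_def by (elim conjE) auto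
  moreover have "if w k = 0 then shock_or_wave S k (v (k - 1)) (z k) (v k) else simple_wave S k (v (k - 1)) (z k) (v k)"
    using assms(2,3) unfolding gRP_def by blast
  ultimately have "simple_wave S k (v (k - 1)) 0 (v k)"
    using assms(5) by (auto split: if_splits)
  then show ?thesis by (auto simp: simple_wave_def)
qed

text \<open>
  A family contributes a chain from \<open>v (k - 1)\<close> to \<open>v k\<close>, or no wave, in which case these states coincide.
  That the intermediate states lie in \<open>states S\<close> is established along the same induction, from the right
  states of the waves already passed.
\<close>

lemma gRP_chain:
  fixes S :: "('n::finite) claw"
  assumes law: "conservation_law S" and gRP: "gRP S w uL uR z v" and uL: "uL \<in> states S"
    and waves: "\<And>k. k \<in> fams S \<Longrightarrow> (if z k = 0 then gss k = [] else wave_chain (v (k - 1)) (gss k) (v k))"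
    and st: "\<And>g. g \<in> set (concat (map gss [1..<Suc CARD('n)])) \<Longrightarrow> rst g \<in> states S"
  shows "wave_chain uL (concat (map gss [1..<Suc CARD('n)])) uR"
proof -
  have "n \<le> CARD('n) \<Longrightarrow> wave_chain uL (concat (map gss [1..<Suc n])) (v n) \<and> v n \<in> states S" for n
  proof (induction n)
    case 0
    then show ?case using gRP uL by (simp add: gRP_def)
  next
    case (Suc n)
    then have k: "Suc n \<in> fams S" by (simp add: fams_def)
    have IH: "wave_chain uL (concat (map gss [1..<Suc n])) (v n)" "v n \<in> states S"
      using Suc by auto
    have c: "wave_chain (v n) (gss (Suc n)) (v (Suc n))"
      using waves[OF k] gRP_null_wave[OF law gRP k] IH(2) by (auto split: if_splits)
    moreover have "v (Suc n) \<in> states S"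
      by (rule wave_chain_end_in[OF c IH(2)]) (use st Suc.prems in force)
    ultimately show ?case using IH(1) by (auto simp: wave_chain_append)
  qed
  from this[of "CARD('n)"] show ?thesis using gRP by (simp add: gRP_def)
qed

text \<open>
  A multi-rarefaction must keep its temporary speed for a positive time, since the position is normalised
  at the birth time only for the motion that precedes \<open>t\<^sup>#\<close>.
\<close>

definition sharp_time_after :: "real \<Rightarrow> ('n::finite) wave \<Rightarrow> bool" where
  "sharp_time_after t g \<longleftrightarrow> (case multi g of None \<Rightarrow> True | Some (ts, _) \<Rightarrow> t < ts)"

lemma outgoing_k_waves:
  assumes "outgoing_k S P t w z v k gs"
  shows "if z k = 0 then gs = [] else wave_chain (v (k - 1)) gs (v k)" "g \<in> set gs \<Longrightarrow> sharp_time_after t g"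
  using assms
  by (auto simp: outgoing_k_def unsplit_wave_def split_along_def sharp_time_after_def split: if_splits)

lemma initial_RP_k_waves:
  assumes "initial_RP_k S P z v k gs"
  shows "if z k = 0 then gs = [] else wave_chain (v (k - 1)) gs (v k)"
  using assms
  by (auto simp: initial_RP_k_def unsplit_wave_def split_along_def split: if_splits)

lemma issues_pos:
  assumes "issues S P n x t c" "sharp_time_after t (carr c)"
  shows "pos c t = x"
  using assms by (auto simp: issues_def sharp_time_after_def pos_def split: option.splits)

text \<open>
  The part of a composite wave on which the approximation depends. The reduction of virtual widths changes
  only the virtual center, so it leaves the trace alone.
\<close>

definition trace :: "('n::finite) composite \<Rightarrow> 'n wave list \<times> (real \<Rightarrow> real)" where
  "trace c = (members c, pos c)"

lemma trace_with_width: "trace (with_width S t w c) = trace c"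
  by (simp add: trace_def with_width_def Let_def pos_def [abs_def])

lemma fix_overlap_trace:
  assumes "fix_overlap S t as bs as' bs'"
  shows "map trace as' = map trace as" "map trace bs' = map trace bs"
proof -
  have "map trace as' = map trace as \<and> map trace bs' = map trace bs"
  proof (cases "as = [] \<or> bs = []")
    case False
    then obtain a' b' where ab: "avoid_overlap S t (last as) (hd bs) a' b'"
      "as' = butlast as @ [a']" "bs' = b' # tl bs"
      using assms by (auto simp: fix_overlap_def)
    have "trace a' = trace (last as)" "trace b' = trace (hd bs)"
      using ab(1) by (auto simp: avoid_overlap_def reduced_width_def trace_with_width split: if_splits)
    moreover have "as = butlast as @ [last as]" "bs = hd bs # tl bs"
      using False by auto
    ultimately show ?thesis
      using ab(2,3) by (metis list.simps(9) map_append)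
  qed (use assms in \<open>auto simp: fix_overlap_def\<close>)
  then show "map trace as' = map trace as" "map trace bs' = map trace bs" by auto
qed

lemma trace_cong:
  assumes "map trace cs' = map trace cs"
  shows "concat (map members cs') = concat (map members cs)"
    "front_sum g cs' t x = front_sum g cs t x"
    "(\<forall>c\<in>set cs'. members c \<noteq> []) \<longleftrightarrow> (\<forall>c\<in>set cs. members c \<noteq> [])"
proof -
  have eq: "map f cs' = map f cs" if "\<And>c. f c = h (trace c)" for f h
  proof -
    have "f = h \<circ> trace" using that by auto
    then show ?thesis using assms by (simp flip: map_map)
  qed
  show "concat (map members cs') = concat (map members cs)"
    using eq[of members fst] by (simp add: trace_def)
  show "front_sum g cs' t x = front_sum g cs t x"
    unfolding front_sum_def jump_def
    by (rule arg_cong[where f=sum_list], rule eq[of _ "\<lambda>(ms, p). heaviside (x - p t) *\<^sub>R (\<Sum>w\<leftarrow>ms. g (rst w) - g (lst w))"])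
       (simp add: trace_def)
  show "(\<forall>c\<in>set cs'. members c \<noteq> []) \<longleftrightarrow> (\<forall>c\<in>set cs. members c \<noteq> [])"
  proof -
    have "members ` set cs' = members ` set cs"
      using arg_cong[OF eq[of members fst], of set] by (simp add: trace_def)
    then have "(\<forall>m\<in>members ` set cs'. m \<noteq> []) \<longleftrightarrow> (\<forall>m\<in>members ` set cs. m \<noteq> [])" by simp
    then show ?thesis by simp
  qed
qed

text \<open>
  Composite waves are required to be nonempty because the outer states of an interaction are read off from
  the first and the last member.
\<close>

definition linked :: "('n::finite) wave_seq \<Rightarrow> bool" where
  "linked \<Gamma> \<longleftrightarrow> (\<exists>u'. wave_chain (ubase \<Gamma>) (all_waves \<Gamma>) u') \<and> (\<forall>c\<in>set (comps \<Gamma>). members c \<noteq> [])"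

text \<open>
  The outgoing waves join the same outer states \<open>uL\<close> and \<open>uR\<close> as the incoming ones and issue from their
  common position. Hence the new sequence is again a chain, and the two step functions coincide at the
  interaction time, for every \<open>g\<close>.
\<close>

lemma mft_step_linked:
  fixes S :: "('n::finite) claw"
  assumes law: "conservation_law S" and step: "mft_step S P n t \<Gamma> \<Gamma>'" and linked: "linked \<Gamma>"
    and states: "ubase \<Gamma> \<in> states S" "\<And>g. g \<in> set (all_waves \<Gamma>) \<Longrightarrow> rst g \<in> states S"
    and states': "\<And>g. g \<in> set (all_waves \<Gamma>') \<Longrightarrow> rst g \<in> states S"
  shows "linked \<Gamma>'" "ubase \<Gamma>' = ubase \<Gamma>" "front_sum g (comps \<Gamma>') t x = front_sum g (comps \<Gamma>) t x"
proof -
  obtain pre inc post w0 w z v gss outs pre' outs1 outs2 post' where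
    \<Gamma>: "comps \<Gamma> = pre @ inc @ post" and int: "interacting S inc t"
    and res: "resolves S P (left_state (hd inc)) (right_state (last inc)) w0 w z v"
    and out: "\<And>k. k \<in> fams S \<Longrightarrow> outgoing_k S P t w z v k (gss k)"
    and grp: "grouping P (concat (map gss [1..<Suc CARD('n)])) outs"
    and iss: "\<And>c. c \<in> set outs \<Longrightarrow> issues S P n (pos (hd inc) t) t c"
    and fix1: "fix_overlap S t pre outs pre' outs1" and fix2: "fix_overlap S t outs1 post outs2 post'"
    and \<Gamma>': "\<Gamma>' = \<lparr>ubase = ubase \<Gamma>, comps = pre' @ outs2 @ post'\<rparr>"
    using step unfolding mft_step_def by blast
  have trace: "map trace pre' = map trace pre" "map trace outs2 = map trace outs" "map trace post' = map trace post"
    using fix_overlap_trace[OF fix1] fix_overlap_trace[OF fix2] by auto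
  let ?W = "\<lambda>cs. concat (map members cs)"
  obtain uL uR u' where ch: "wave_chain (ubase \<Gamma>) (?W pre) uL" "wave_chain uL (?W inc) uR" "wave_chain uR (?W post) u'"
    using linked by (auto simp: linked_def all_waves_def \<Gamma> wave_chain_append)
  have ne: "\<And>c. c \<in> set inc \<Longrightarrow> members c \<noteq> []" "\<forall>c\<in>set pre. members c \<noteq> []" "\<forall>c\<in>set post. members c \<noteq> []"
    using linked by (auto simp: linked_def \<Gamma>)
  have inc: "inc \<noteq> []" "\<And>c. c \<in> set inc \<Longrightarrow> pos c t = pos (hd inc) t"
    using int by (auto simp: interacting_def meets_def)
  have outer: "left_state (hd inc) = uL" "right_state (last inc) = uR"
  proof -
    have "?W inc \<noteq> []" using inc(1) ne(1) by (cases inc) auto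
    note e = wave_chain_ends[OF ch(2) this]
    have "hd (?W inc) = hd (members (hd inc))" using inc(1) ne(1) by (cases inc) auto
    moreover have "last (?W inc) = last (members (last inc))"
      using inc(1) ne(1)[of "last inc"] by (cases inc rule: rev_cases) auto
    ultimately show "left_state (hd inc) = uL" "right_state (last inc) = uR"
      using e by (auto simp: left_state_def right_state_def)
  qed
  have uL: "uL \<in> states S"
    by (rule wave_chain_end_in[OF ch(1)]) (auto intro!: states simp: all_waves_def \<Gamma>)
  have gRP: "gRP S w uL uR z v"
    using res unfolding outer by induction auto
  have outs: "?W outs = concat (map gss [1..<Suc CARD('n)])"
    using grp by (simp add: grouping_def)
  have "\<And>g. g \<in> set (?W outs) \<Longrightarrow> rst g \<in> states S"
    using states' unfolding all_waves_def \<Gamma>' by (simp add: trace_cong(1)[OF trace(2)])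
  then have chO: "wave_chain uL (?W outs) uR"
    unfolding outs by (intro gRP_chain[OF law gRP uL outgoing_k_waves(1)[OF out]]) auto
  have cix: "carrier_ix c < length (members c)" if "c \<in> set outs" for c
    using grp that by (simp add: grouping_def)
  have posO: "pos c t = pos (hd inc) t" if c: "c \<in> set outs" for c
  proof (rule issues_pos[OF iss[OF c]])
    have "carr c \<in> set (?W outs)"
      using c cix[OF c] by (auto simp: carr_def intro!: bexI[of _ c])
    then obtain k where "k \<in> fams S" "carr c \<in> set (gss k)"
      unfolding outs fams_def by (force simp del: upt_Suc)
    then show "sharp_time_after t (carr c)"
      using outgoing_k_waves(2)[OF out] by blast
  qed
  show "ubase \<Gamma>' = ubase \<Gamma>" by (simp add: \<Gamma>')
  have "wave_chain (ubase \<Gamma>) (?W (pre @ outs @ post)) u'"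
    using ch chO by (auto simp: wave_chain_append)
  moreover have "\<forall>c\<in>set outs. members c \<noteq> []" using cix by fastforce
  ultimately show "linked \<Gamma>'"
    using ne trace_cong(1,3)[OF trace(1)] trace_cong(1,3)[OF trace(2)] trace_cong(1,3)[OF trace(3)]
    unfolding linked_def all_waves_def \<Gamma>' by (auto simp: ball_Un)
  have "front_sum g inc t x = front_sum g outs t x"
    using front_sum_same_position[OF inc(2) ch(2)] front_sum_same_position[OF posO chO] by simp
  then show "front_sum g (comps \<Gamma>') t x = front_sum g (comps \<Gamma>) t x"
    by (simp add: \<Gamma> \<Gamma>' trace_cong(2)[OF trace(1)] trace_cong(2)[OF trace(2)] trace_cong(2)[OF trace(3)])
qed

text \<open>
  Rewrites a list with one entry for each index satisfying \<open>Q\<close> as blocks over all indices, empty where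
  \<open>Q\<close> fails. This brings the initial waves into the form in which \<open>gRP_chain\<close> treats the waves family by
  family.
\<close>

lemma list_all2_filter_blocks:
  assumes "list_all2 R cs (filter Q ks)" "distinct ks"
  shows "\<exists>gss. concat (map h cs) = concat (map gss ks) \<and>
    (\<forall>k\<in>set ks. if Q k then \<exists>c\<in>set cs. R c k \<and> gss k = h c else gss k = [])"
  using assms
proof (induction ks arbitrary: cs)
  case (Cons k ks)
  have upd: "map (gss(k := y)) ks = map gss ks" for gss y
    using Cons.prems(2) by (intro map_cong) auto
  show ?case
  proof (cases "Q k")
    case True
    then obtain c cs' where cs: "cs = c # cs'" "R c k" "list_all2 R cs' (filter Q ks)"
      using Cons.prems(1) by (auto simp: list_all2_Cons2)
    with Cons.IH[of cs'] Cons.prems(2) obtain gss where gss: "concat (map h cs') = concat (map gss ks)"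
      "\<And>k. k \<in> set ks \<Longrightarrow> if Q k then \<exists>c\<in>set cs'. R c k \<and> gss k = h c else gss k = []" by auto
    show ?thesis
    proof (intro exI[of _ "gss(k := h c)"] conjI ballI)
      show "concat (map h cs) = concat (map (gss(k := h c)) (k # ks))"
        using gss(1) cs True by (simp only: list.map concat.simps upd fun_upd_same)
      show "if Q k' then \<exists>d\<in>set cs. R d k' \<and> (gss(k := h c)) k' = h d else (gss(k := h c)) k' = []"
        if "k' \<in> set (k # ks)" for k'
        using that gss(2)[of k'] cs True Cons.prems(2) by auto
    qed
  next
    case False
    with Cons.IH[of cs] Cons.prems obtain gss where gss: "concat (map h cs) = concat (map gss ks)"
      "\<And>k. k \<in> set ks \<Longrightarrow> if Q k then \<exists>c\<in>set cs. R c k \<and> gss k = h c else gss k = []" by auto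
    show ?thesis
    proof (intro exI[of _ "gss(k := [])"] conjI ballI)
      show "concat (map h cs) = concat (map (gss(k := [])) (k # ks))"
        using gss(1) by (simp only: list.map concat.simps upd fun_upd_same) simp
      show "if Q k' then \<exists>c\<in>set cs. R c k' \<and> (gss(k := [])) k' = h c else (gss(k := [])) k' = []"
        if "k' \<in> set (k # ks)" for k'
        using that gss(2)[of k'] False Cons.prems(2) by auto
    qed
  qed
qed auto

lemma initial_interval_linked:
  fixes S :: "('n::finite) claw"
  assumes law: "conservation_law S" and ivl: "initial_interval S P a b uL uR cs" and uL: "uL \<in> states S"
    and st: "\<And>g. g \<in> set (concat (map members cs)) \<Longrightarrow> rst g \<in> states S"
  shows "wave_chain uL (concat (map members cs)) uR" "\<forall>c\<in>set cs. members c \<noteq> []"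
proof -
  obtain w z v where gRP: "gRP S w uL uR z v"
    and cs: "list_all2 (\<lambda>c k. \<exists>g. members c = [g] \<and> unsplit_wave S P w z v k g)
      cs (filter (\<lambda>k. z k \<noteq> 0) [1..<Suc CARD('n)])"
  proof -
    obtain w z v where gRP: "gRP S w uL uR z v"
      and cs: "list_all2 (\<lambda>c k. \<exists>g. members c = [g] \<and> carrier_ix c = 0 \<and> unsplit_wave S P w z v k g \<and>
            (\<exists>w' \<le> w k. (wtype g = Simple \<longrightarrow> 0 < w') \<and> ctime g = center_time S 0 w' g) \<and>
            issues S P 0 (xbirth c) 0 c \<and> a < xbirth c \<and> xbirth c < b \<and>
            a < left_edge S c 0 \<and> right_edge S c 0 < b)
          cs (filter (\<lambda>k. z k \<noteq> 0) [1..<Suc CARD('n)])"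
      using ivl unfolding initial_interval_def by blast
    show thesis
      by (rule that[OF gRP list_all2_mono[OF cs]]) blast
  qed
  obtain gss where
    gss: "concat (map members cs) = concat (map gss [1..<Suc CARD('n)])"
    "\<And>k. k \<in> fams S \<Longrightarrow> if z k \<noteq> 0 then \<exists>g. gss k = [g] \<and> unsplit_wave S P w z v k g else gss k = []"
  proof -
    assume that: "\<And>gss. concat (map members cs) = concat (map gss [1..<Suc CARD('n)]) \<Longrightarrow>
      (\<And>k. k \<in> fams S \<Longrightarrow> if z k \<noteq> 0 then \<exists>g. gss k = [g] \<and> unsplit_wave S P w z v k g else gss k = []) \<Longrightarrow> thesis"
    obtain gss where eq: "concat (map members cs) = concat (map gss [1..<Suc CARD('n)])"
      and k: "\<And>k. k \<in> set [1..<Suc CARD('n)] \<Longrightarrow>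
        if z k \<noteq> 0 then \<exists>c\<in>set cs. (\<exists>g. members c = [g] \<and> unsplit_wave S P w z v k g) \<and> gss k = members c
        else gss k = []"
      using list_all2_filter_blocks[OF cs distinct_upt, of members] by blast
    have "if z k \<noteq> 0 then \<exists>g. gss k = [g] \<and> unsplit_wave S P w z v k g else gss k = []" if "k \<in> fams S" for k
    proof -
      have "k \<in> set [1..<Suc CARD('n)]" using that by (auto simp: fams_def)
      from k[OF this] show ?thesis by (auto split: if_splits)
    qed
    with eq show thesis by (rule that)
  qed
  show "wave_chain uL (concat (map members cs)) uR"
    unfolding gss(1)
  proof (rule gRP_chain[OF law gRP uL])
    show "if z k = 0 then gss k = [] else wave_chain (v (k - 1)) (gss k) (v k)" if "k \<in> fams S" for k
      using gss(2)[OF that] by (auto simp: unsplit_wave_def split: if_splits)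
  qed (use st gss(1) in auto)
  show "\<forall>c\<in>set cs. members c \<noteq> []"
    using cs by (fastforce simp: list_all2_conv_all_nth in_set_conv_nth)
qed

lemma initial_RP_linked:
  fixes S :: "('n::finite) claw"
  assumes law: "conservation_law S" and RP: "initial_RP S P x uL uR cs" and uL: "uL \<in> states S"
    and st: "\<And>g. g \<in> set (concat (map members cs)) \<Longrightarrow> rst g \<in> states S"
  shows "wave_chain uL (concat (map members cs)) uR" "\<forall>c\<in>set cs. members c \<noteq> []"
proof -
  obtain z v gss where gRP: "gRP S (\<lambda>_. 0) uL uR z v"
    and k: "\<And>k. k \<in> fams S \<Longrightarrow> initial_RP_k S P z v k (gss k)"
    and grp: "grouping P (concat (map gss [1..<Suc CARD('n)])) cs"
    using RP unfolding initial_RP_def by blast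
  have eq: "concat (map members cs) = concat (map gss [1..<Suc CARD('n)])"
    using grp by (simp add: grouping_def)
  show "wave_chain uL (concat (map members cs)) uR"
    unfolding eq by (rule gRP_chain[OF law gRP uL initial_RP_k_waves[OF k]]) (use st eq in auto)
  show "\<forall>c\<in>set cs. members c \<noteq> []"
    using grp by (fastforce simp: grouping_def)
qed

text \<open>
  The chain is followed along the grid: it reaches \<open>l (j + 1)\<close> at the end of the interval starting from
  \<open>r j\<close>, and \<open>r (j + 1)\<close> after the Riemann problem at that grid point, or at once where the data are
  continuous. At the last grid point it ends with the left limit.
\<close>

lemma mft_init_linked:
  fixes S :: "('n::finite) claw"
  assumes law: "conservation_law S" and init: "mft_init S P uo \<Gamma>"
    and states: "ubase \<Gamma> \<in> states S" "\<And>g. g \<in> set (all_waves \<Gamma>) \<Longrightarrow> rst g \<in> states S"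
  shows "linked \<Gamma>"
proof -
  obtain m xs l r ivl pts where m: "1 \<le> m"
    and ivl: "\<And>j. j \<in> {1..m} \<Longrightarrow> initial_interval S P (xs ! (j - 1)) (xs ! j) (r (j - 1)) (l j) (ivl j)"
    and pts: "\<And>j. j \<in> {1..<m} \<Longrightarrow> initial_RP S P (xs ! j) (l j) (r j) (pts j) \<or> r j = l j \<and> pts j = []"
    and ptm: "pts m = []"
    and \<Gamma>: "\<Gamma> = \<lparr>ubase = r 0, comps = concat (map (\<lambda>j. ivl j @ pts j) [1..<Suc m])\<rparr>"
    using init unfolding mft_init_def Let_def by (metis (no_types, lifting))
  let ?W = "\<lambda>cs. concat (map members cs)"
  let ?C = "\<lambda>j. concat (map (\<lambda>j. ivl j @ pts j) [1..<Suc j])"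
  have st: "rst g \<in> states S" if "g \<in> set (?W (ivl j)) \<or> g \<in> set (?W (pts j))" "j \<in> {1..m}" for g j
    using that by (intro states) (force simp: all_waves_def \<Gamma> simp del: upt_Suc)
  have "j \<le> m \<Longrightarrow> wave_chain (r 0) (?W (?C j)) (if j < m then r j else l j) \<and>
      (if j < m then r j else l j) \<in> states S \<and> (\<forall>c\<in>set (?C j). members c \<noteq> [])" for j
  proof (induction j)
    case 0
    then show ?case using m states(1) by (simp add: \<Gamma>)
  next
    case (Suc j)
    let ?u = "if Suc j < m then r (Suc j) else l (Suc j)"
    have j: "Suc j \<in> {1..m}" using Suc.prems by simp
    have IH: "wave_chain (r 0) (?W (?C j)) (r j)" "r j \<in> states S" "\<forall>c\<in>set (?C j). members c \<noteq> []"
      using Suc by auto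
    have i: "wave_chain (r j) (?W (ivl (Suc j))) (l (Suc j))" "\<forall>c\<in>set (ivl (Suc j)). members c \<noteq> []"
      using initial_interval_linked[OF law ivl[OF j]] IH(2) st[OF _ j] by auto
    have l: "l (Suc j) \<in> states S"
      by (rule wave_chain_end_in[OF i(1) IH(2)]) (use st[OF _ j] in auto)
    have p: "wave_chain (l (Suc j)) (?W (pts (Suc j))) ?u" "\<forall>c\<in>set (pts (Suc j)). members c \<noteq> []"
      using initial_RP_linked[OF law _ l st[OF _ j]] pts[of "Suc j"] ptm Suc.prems
      by (cases "Suc j = m"; fastforce)+
    have "?u \<in> states S"
      by (rule wave_chain_end_in[OF p(1) l]) (use st[OF _ j] in auto)
    moreover have "?C (Suc j) = ?C j @ ivl (Suc j) @ pts (Suc j)" by simp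
    ultimately show ?case
      using IH(1,3) i p by (simp only: map_append concat_append wave_chain_append set_append) blast
  qed
  from this[of m] show ?thesis
    by (auto simp: linked_def all_waves_def \<Gamma>)
qed

section \<open>Regularity of the approximation\<close>

lemma AE_off_fronts:
  assumes "\<And>x. (\<And>c. c \<in> set cs \<Longrightarrow> pos c t \<noteq> x) \<Longrightarrow> Q x"
  shows "AE x in lebesgue. Q x"
proof (rule AE_I')
  let ?X = "(\<lambda>c. pos c t) ` set cs"
  show "?X \<in> null_sets lebesgue"
    using negligible_finite[of ?X] by (simp add: negligible_iff_null_sets)
  show "{x \<in> space lebesgue. \<not> Q x} \<subseteq> ?X"
  proof
    fix x assume "x \<in> {x \<in> space lebesgue. \<not> Q x}"
    then show "x \<in> ?X" using assms[of x] by auto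
  qed
qed

context
  fixes S :: "('n::finite) claw" and P :: mft_params and uo :: "real \<Rightarrow> real^'n"
    and T :: real and tt :: "nat \<Rightarrow> real" and \<Gamma> :: "nat \<Rightarrow> 'n wave_seq"
  assumes law: "conservation_law S" and run: "mft_run S P uo T tt \<Gamma>"
begin

lemma run_times: "tt 0 = 0" "tt j \<le> tt (Suc j)"
  using run by (simp_all add: mft_run_def)

lemma run_states:
  assumes "tt j < T"
  shows "ubase (\<Gamma> j) \<in> states S" "g \<in> set (all_waves (\<Gamma> j)) \<Longrightarrow> rst g \<in> states S"
proof -
  have "compact_states S \<subseteq> states S"
    using law by (simp add: conservation_law_def)
  then show "ubase (\<Gamma> j) \<in> states S" "g \<in> set (all_waves (\<Gamma> j)) \<Longrightarrow> rst g \<in> states S"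
    using run assms unfolding mft_run_def by blast+
qed

lemma run_sorted:
  "tt j < T \<Longrightarrow> t \<in> {tt j..<tt (Suc j)} \<Longrightarrow> sorted (map (\<lambda>c. pos c t) (comps (\<Gamma> j)))"
  using run unfolding mft_run_def by blast

lemma run_step: "tt (Suc j) < T \<Longrightarrow> mft_step S P (Suc j) (tt (Suc j)) (\<Gamma> j) (\<Gamma> (Suc j))"
  using run unfolding mft_run_def by blast

lemma run_linked: "tt j < T \<Longrightarrow> linked (\<Gamma> j)"
proof (induction j)
  case 0
  then show ?case
    using run by (intro mft_init_linked[OF law _ run_states]) (auto simp: mft_run_def)
next
  case (Suc j)
  then have "tt j < T" using run_times(2)[of j] by simp
  then show ?case
    by (intro mft_step_linked(1)[OF law run_step[OF Suc.prems] Suc.IH run_states run_states(2)[OF Suc.prems]])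
qed

text \<open>
  Both claims come from one wave state \<open>s\<close>: with the identity for \<open>g\<close> it is the value of the approximation,
  and with the given \<open>g\<close> the front sum evaluates to \<open>g s\<close>.
\<close>

lemma run_value:
  assumes "tt j < T" "t \<in> {tt j..<tt (Suc j)}" "\<And>c. c \<in> set (comps (\<Gamma> j)) \<Longrightarrow> pos c t \<noteq> x"
  shows "mft_approx tt \<Gamma> t x \<in> states S"
    "g (mft_approx tt \<Gamma> t x) = g (ubase (\<Gamma> j)) + front_sum g (comps (\<Gamma> j)) t x"
proof -
  interpret time_slots tt j using run_times by unfold_locales
  have a: "mft_approx tt \<Gamma> t x = ubase (\<Gamma> j) + front_sum (\<lambda>u. u) (comps (\<Gamma> j)) t x"
    using time_slot_eq[OF assms(2)] by (simp add: mft_approx_def time_slot_def approx_eq_front_sum)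
  obtain u' where "wave_chain (ubase (\<Gamma> j)) (concat (map members (comps (\<Gamma> j)))) u'"
    using run_linked[OF assms(1)] by (auto simp: linked_def all_waves_def)
  from front_sum_sorted[OF this run_sorted[OF assms(1,2)] assms(3)]
  obtain s where s: "s \<in> insert (ubase (\<Gamma> j)) (rst ` set (all_waves (\<Gamma> j)))"
    "\<And>g. g (ubase (\<Gamma> j)) + front_sum g (comps (\<Gamma> j)) t x = g s"
    unfolding all_waves_def by blast
  have "s \<in> states S" using s(1) run_states[OF assms(1)] by blast
  then show "mft_approx tt \<Gamma> t x \<in> states S"
    "g (mft_approx tt \<Gamma> t x) = g (ubase (\<Gamma> j)) + front_sum g (comps (\<Gamma> j)) t x"
    using s(2)[of "\<lambda>u. u"] s(2)[of g] a by simp_all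
qed

text \<open>
  The paths of the fronts are those of the approximation itself, only the jumps depend on \<open>g\<close>; thus a
  single argument covers the approximation, the flux and the conserved quantity.
\<close>

lemma run_front_evolution:
  assumes i: "tt i < T"
  shows "front_evolution tt i (\<lambda>j. length (comps (\<Gamma> j))) (\<lambda>j. g (ubase (\<Gamma> j)))
    (\<lambda>j k. jump g (comps (\<Gamma> j) ! k)) (\<lambda>j k. pos (comps (\<Gamma> j) ! k)) (\<lambda>j k. front_speed (comps (\<Gamma> j) ! k))
    (\<lambda>j k. tsharp (comps (\<Gamma> j) ! k)) (\<lambda>t x. g (mft_approx tt \<Gamma> t x))"
proof -
  interpret time_slots tt i using run_times by unfold_locales
  have T: "tt j < T" if "j \<le> i" for j
    using tt_mono[OF that] i by simp
  show ?thesis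
  proof unfold_locales
    fix j assume j: "j < i"
    then have t: "tt j < T" "tt (Suc j) < T" using T by simp_all
    note step = mft_step_linked(2,3)[OF law run_step[OF t(2)] run_linked[OF t(1)] run_states[OF t(1)] run_states(2)[OF t(2)]]
    have "ubase (\<Gamma> (Suc j)) = ubase (\<Gamma> j)" by (rule step(1))
    moreover have "front_sum g (comps (\<Gamma> (Suc j))) (tt (Suc j)) x = front_sum g (comps (\<Gamma> j)) (tt (Suc j)) x" for x
      by (rule step(2))
    ultimately show "step_fun (g (ubase (\<Gamma> j))) (length (comps (\<Gamma> j))) (\<lambda>k. pos (comps (\<Gamma> j) ! k) (tt (Suc j)))
        (\<lambda>k. jump g (comps (\<Gamma> j) ! k)) =
      step_fun (g (ubase (\<Gamma> (Suc j)))) (length (comps (\<Gamma> (Suc j)))) (\<lambda>k. pos (comps (\<Gamma> (Suc j)) ! k) (tt (Suc j)))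
        (\<lambda>k. jump g (comps (\<Gamma> (Suc j)) ! k))"
      by (intro ext) (simp flip: front_sum_eq_step_fun)
  next
    fix j t assume j: "j \<le> i" "t \<in> {tt j..<tt (Suc j)}"
    show "AE x in lebesgue. g (mft_approx tt \<Gamma> t x) = step_fun (g (ubase (\<Gamma> j))) (length (comps (\<Gamma> j)))
        (\<lambda>k. pos (comps (\<Gamma> j) ! k) t) (\<lambda>k. jump g (comps (\<Gamma> j) ! k)) x"
      unfolding front_sum_eq_step_fun[symmetric]
      by (rule AE_off_fronts[of "comps (\<Gamma> j)" t]) (rule run_value(2)[OF T[OF j(1)] j(2)])
  qed (auto intro: pos_continuous pos_deriv front_speed_measurable front_speed_bounded)
qed

end

theorem theorem1p1:
  fixes S :: "('n::finite) claw" and P :: mft_params and uo :: "real \<Rightarrow> real^'n"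
    and T :: real and tt :: "nat \<Rightarrow> real" and \<Gamma> :: "nat \<Rightarrow> 'n wave_seq" and i :: nat
  assumes "conservation_law S"
    and "scheme_params P"
    and "uo \<in> BV_loc" and "AE x in lebesgue. uo x \<in> states S"
    and "mft_run S P uo T tt \<Gamma>"
    and "tt i < T"
  shows "variation (\<Gamma> i) < \<infinity> \<and>
    mft_approx tt \<Gamma> \<in> W1inf (tt (Suc i)) \<and>
    mft_approx tt \<Gamma> \<in> Z_space S (tt (Suc i)) \<and>
    (\<lambda>t x. ffun S (mft_approx tt \<Gamma> t x)) \<in> Linf_BV (tt (Suc i)) \<and>
    (\<lambda>t x. qfun S (mft_approx tt \<Gamma> t x)) \<in> W1inf (tt (Suc i))"
proof -
  have "(\<Sum>g\<leftarrow>ws. ennreal \<bar>str g\<bar>) < \<infinity>" for ws :: "'n wave list"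
    by (induction ws) (simp_all add: ennreal_add_less_top)
  then have variation: "variation (\<Gamma> i) < \<infinity>"
    by (simp add: variation_def)
  have W: "(\<lambda>t x. g (mft_approx tt \<Gamma> t x)) \<in> W1inf (tt (Suc i))" for g :: "real^'n \<Rightarrow> real^'n"
    by (rule front_evolution.u_W1inf[OF run_front_evolution[OF assms(1,5,6)]])
  have u: "mft_approx tt \<Gamma> \<in> W1inf (tt (Suc i))"
    using W[of "\<lambda>u. u"] by simp
  have f: "(\<lambda>t x. ffun S (mft_approx tt \<Gamma> t x)) \<in> Linf_BV (tt (Suc i))"
    using W[of "ffun S"] by (simp add: W1inf_def)
  have "AE x in lebesgue. mft_approx tt \<Gamma> t x \<in> states S" if t: "t \<in> {0<..<tt (Suc i)}" for t
  proof -
    interpret time_slots tt i using run_times[OF assms(1,5)] by unfold_locales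
    have T: "tt (time_slot tt t) < T"
      using tt_mono[OF time_slot(1)[OF t]] assms(6) by simp
    show ?thesis
      by (rule AE_off_fronts[of "comps (\<Gamma> (time_slot tt t))" t])
         (rule run_value(1)[OF assms(1,5) T time_slot(2)[OF t]])
  qed
  then have "mft_approx tt \<Gamma> \<in> Z_space S (tt (Suc i))"
    using f W[of "qfun S"] by (simp add: Z_space_def)
  with variation u f W[of "qfun S"] show ?thesis by blast
qed

end
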